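(* Let $L\subseteq[0,\infty)^r$ be an additive semigroup with $0\in L$, $f$ a holomorphic function on a region $G\subseteq\mathbb C$, and $w$ an admissible weight function on $L$. If $a\in\mathscr A_w(L)$ satisfies $\overline{\widetilde a(\mathbb H^r)}\subseteq G$, then there exists $c\in\mathscr A_w(L)$ with $f\circ\widetilde a=\widetilde c$.
   Context: $\mathbb H=\{\operatorname{Re}s>0\}$. A weight function is $w\colon L\to(0,\infty)$ with $w(0)=1$, $w(\lambda+\lambda')\le w(\lambda)w(\lambda')$; admissible: $w\ge1$ and $\lim_{k\to\infty}w(k\lambda)^{1/k}=1$ for all $\lambda\in L$. $\mathscr A_w(L)$: functions $a\colon L\to\mathbb C$ with $\sum_{\lambda\in L}|a(\lambda)|w(\lambda)<\infty$ and convolution $(a*b)(\lambda)=\sum_{\lambda'+\lambda''=\lambda}a(\lambda')b(\lambda'')$. $\widetilde a(s)=\sum_{\lambda\in L}a(\lambda)e^{-\lambda\cdot s}$ for $s\in\overline{\mathbb H}^r$, with $\lambda\cdot s=\sum_\varrho\lambda_\varrho s_\varrho$. *)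

theory Defs
  imports "HOL-Analysis.Analysis"
begin

definition nonneg_semigroup :: "(real^'r) set \<Rightarrow> bool" where
  "nonneg_semigroup L \<longleftrightarrow> 0 \<in> L \<and> (\<forall>x\<in>L. \<forall>y\<in>L. x + y \<in> L)
     \<and> (\<forall>x\<in>L. \<forall>i. 0 \<le> x $ i)"

definition weight_function :: "(real^'r) set \<Rightarrow> (real^'r \<Rightarrow> real) \<Rightarrow> bool" where
  "weight_function L w \<longleftrightarrow> (\<forall>l\<in>L. 0 < w l) \<and> w 0 = 1 \<and>
     (\<forall>l\<in>L. \<forall>l'\<in>L. w (l + l') \<le> w l * w l')"

definition admissible_weight :: "(real^'r) set \<Rightarrow> (real^'r \<Rightarrow> real) \<Rightarrow> bool" where
  "admissible_weight L w \<longleftrightarrow> weight_function L w \<and> (\<forall>l\<in>L. 1 \<le> w l) \<and>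
     (\<forall>l\<in>L. ((\<lambda>k::nat. w (real k *\<^sub>R l) powr (1 / real k)) \<longlongrightarrow> 1) sequentially)"

definition Aw :: "(real^'r) set \<Rightarrow> (real^'r \<Rightarrow> real) \<Rightarrow> (real^'r \<Rightarrow> complex) set" where
  "Aw L w = {a. (\<forall>l. l \<notin> L \<longrightarrow> a l = 0) \<and> (\<lambda>l. norm (a l) * w l) summable_on L}"

definition dotc :: "real^'r \<Rightarrow> complex^'r \<Rightarrow> complex" where
  "dotc l s = (\<Sum>i\<in>UNIV. complex_of_real (l $ i) * s $ i)"

definition gtrans :: "(real^'r) set \<Rightarrow> (real^'r \<Rightarrow> complex) \<Rightarrow> complex^'r \<Rightarrow> complex" where
  "gtrans L a s = (\<Sum>\<^sub>\<infinity>l\<in>L. a l * exp (- dotc l s))"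

definition Hr :: "(complex^'r) set" where
  "Hr = {s. \<forall>i. 0 < Re (s $ i)}"

definition Hr_closed :: "(complex^'r) set" where
  "Hr_closed = {s. \<forall>i. 0 \<le> Re (s $ i)}"

end

(* The algebra is a Banach algebra under the weighted norm. Let x be an element whose transform is
   bounded by sigma on the closed half space. If x is finitely supported, then x^k has at most
   (k+1)^n coefficients, each of modulus at most sigma^k (averaging over imaginary translations),
   and the weight is subexponential on its support; so the spectral radius of x is at most sigma.
   By density this holds for every x.

   If |F| >= delta for a transform F, then F is invertible: the translates F(s + t(1,...,1)) depend
   uniformly continuously on t and are close to a constant for large t. By the bound on spectral
   radii, each Neumann step in t has a length depending only on delta, so finitely many of them lead
   from large t down to t = 0. No Gelfand theory is involved.

   Finally f(F) is a Cauchy integral over finitely many segments that avoid the closure K of the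
   range of F. On a segment [p, q] shorter than its distance from K, expanding 1/(u - F) in powers
   of (u - p)/(F - p) turns the integral into a series in the powers of 1/(F - p), which converges
   in norm by the spectral radius bound. *)

theory Submission
  imports Defs "HOL-Complex_Analysis.Complex_Analysis"
begin

section \<open>Representable functions\<close>

locale admissible_semigroup =
  fixes L :: "(real^'r) set" and w :: "real^'r \<Rightarrow> real"
  assumes semigroup: "nonneg_semigroup L" and admissible: "admissible_weight L w"
begin

lemma zero_mem: "0 \<in> L"
  using semigroup by (simp add: nonneg_semigroup_def)

lemma add_mem: "x \<in> L \<Longrightarrow> y \<in> L \<Longrightarrow> x + y \<in> L"
  using semigroup by (simp add: nonneg_semigroup_def)

lemma nonneg_mem: "x \<in> L \<Longrightarrow> 0 \<le> x $ i"
  using semigroup by (simp add: nonneg_semigroup_def)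

lemma weight_ge_1: "x \<in> L \<Longrightarrow> 1 \<le> w x"
  using admissible by (simp add: admissible_weight_def)

lemma weight_zero: "w 0 = 1"
  using admissible by (simp add: admissible_weight_def weight_function_def)

lemma weight_add: "x \<in> L \<Longrightarrow> y \<in> L \<Longrightarrow> w (x + y) \<le> w x * w y"
  using admissible by (simp add: admissible_weight_def weight_function_def)

lemma weight_nonneg: "x \<in> L \<Longrightarrow> 0 \<le> w x"
  using weight_ge_1 by fastforce

end

lemma dotc_zero_left: "dotc 0 s = 0"
  by (simp add: dotc_def)

lemma dotc_add_left: "dotc (x + y) s = dotc x s + dotc y s"
  by (simp add: dotc_def sum.distrib algebra_simps)

lemma dotc_add_right: "dotc x (s + t) = dotc x s + dotc x t"
  by (simp add: dotc_def sum.distrib algebra_simps)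

context admissible_semigroup
begin

lemma norm_exp_dotc_le:
  assumes "x \<in> L" "s \<in> Hr_closed"
  shows "norm (exp (- dotc x s)) \<le> 1"
proof -
  have "0 \<le> Re (dotc x s)"
    using assms nonneg_mem by (auto simp: dotc_def Hr_closed_def intro!: sum_nonneg)
  then show ?thesis by simp
qed

text \<open>Sums and products are taken of the transforms instead of the coefficient functions, so the
  algebra laws of the convolution are never needed, nor is injectivity of the transform.\<close>

definition rep :: "(complex^'r \<Rightarrow> complex) \<Rightarrow> real \<Rightarrow> bool" where
  "rep F M \<longleftrightarrow> (\<exists>a m. (\<forall>l. l \<notin> L \<longrightarrow> a l = 0) \<and> m \<le> M \<and>
     ((\<lambda>l. norm (a l) * w l) has_sum m) L \<and>
     (\<forall>s\<in>Hr_closed. ((\<lambda>l. a l * exp (- dotc l s)) has_sum F s) L))"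

text \<open>As \<open>w\<close> is at least 1 on \<open>L\<close>, weighted summability implies
  absolute summability; \<open>\<beta>\<close> stands for the exponential factors, or for 1.\<close>

lemma summable_family:
  assumes "\<And>i. i \<in> I \<Longrightarrow> \<mu> i \<in> L"
    and "(\<lambda>i. norm (\<alpha> i) * w (\<mu> i)) summable_on I"
    and "\<And>i. i \<in> I \<Longrightarrow> norm (\<beta> i) \<le> 1"
  shows "(\<lambda>i. norm (\<alpha> i * \<beta> i :: complex)) summable_on I"
proof (rule summable_on_comparison_test[OF assms(2)])
  fix i assume i: "i \<in> I"
  have "norm (\<alpha> i) * norm (\<beta> i) \<le> norm (\<alpha> i) * 1"
    using assms(3)[OF i] by (intro mult_left_mono) auto
  also have "\<dots> \<le> norm (\<alpha> i) * w (\<mu> i)"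
    using weight_ge_1[OF assms(1)[OF i]] by (intro mult_left_mono) auto
  finally show "norm (\<alpha> i * \<beta> i) \<le> norm (\<alpha> i) * w (\<mu> i)"
    by (simp add: norm_mult)
qed auto

text \<open>Coefficients of equal frequency are merged by summing over the fibres of
  \<open>\<mu>\<close>; by the triangle inequality this does not increase the weighted norm. All
  later constructions of representable functions rest on this.\<close>

lemma rep_family:
  fixes \<alpha> :: "'i \<Rightarrow> complex"
  assumes \<mu>: "\<And>i. i \<in> I \<Longrightarrow> \<mu> i \<in> L"
    and summ: "((\<lambda>i. norm (\<alpha> i) * w (\<mu> i)) has_sum M) I"
    and F: "\<And>s. s \<in> Hr_closed \<Longrightarrow> ((\<lambda>i. \<alpha> i * exp (- dotc (\<mu> i) s)) has_sum F s) I"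
  shows "rep F M"
proof -
  define B where "B l = {i \<in> I. \<mu> i = l}" for l
  define c where "c l = infsum \<alpha> (B l)" for l
  have abs: "(\<lambda>i. norm (\<alpha> i)) summable_on I"
    using summable_family[OF \<mu> has_sum_imp_summable[OF summ], of "\<lambda>_. 1"] by simp
  \<comment> \<open>The fibres partition \<open>I\<close>. The type of the values is left open,
    since real and complex sums are both regrouped.\<close>
  have regroup: "(f has_sum x) I \<longleftrightarrow> ((\<lambda>p. f (snd p)) has_sum x) (Sigma L B)"
    for f :: "'i \<Rightarrow> 'b::topological_comm_monoid_add" and x
    by (rule has_sum_reindex_bij_witness[of _ snd "\<lambda>i. (\<mu> i, i)"]) (auto simp: B_def \<mu>)
  have BI: "B l \<subseteq> I" for l by (auto simp: B_def)
  have absB: "(\<lambda>i. norm (\<alpha> i)) summable_on B l" for l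
    using summable_on_subset[OF abs BI] .
  have sumB: "(\<alpha> has_sum c l) (B l)" for l
    unfolding c_def by (rule has_sum_infsum, rule abs_summable_summable, rule absB)
  have "c l = 0" if "l \<notin> L" for l
  proof -
    have "B l = {}" using that \<mu> by (auto simp: B_def)
    then show ?thesis by (simp add: c_def)
  qed
  moreover have "((\<lambda>l. c l * exp (- dotc l s)) has_sum F s) L" if s: "s \<in> Hr_closed" for s
  proof (rule has_sum_Sigma')
    show "((\<lambda>p. \<alpha> (snd p) * exp (- dotc (\<mu> (snd p)) s)) has_sum F s) (Sigma L B)"
      using F[OF s] by (rule regroup[THEN iffD1])
    fix l assume "l \<in> L"
    have "((\<lambda>i. \<alpha> i * exp (- dotc l s)) has_sum c l * exp (- dotc l s)) (B l)"
      by (intro has_sum_cmult_left sumB)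
    then show "((\<lambda>i. \<alpha> (snd (l, i)) * exp (- dotc (\<mu> (snd (l, i))) s))
        has_sum c l * exp (- dotc l s)) (B l)"
      by (subst has_sum_cong[where g = "\<lambda>i. \<alpha> i * exp (- dotc l s)"]) (auto simp: B_def)
  qed
  \<comment> \<open>Cancellation inside a fibre can make the norm smaller than \<open>M\<close>;
    this is why \<open>rep\<close> asks only for an upper bound.\<close>
  moreover have "\<exists>m\<le>M. ((\<lambda>l. norm (c l) * w l) has_sum m) L"
  proof -
    define g where "g l = infsum (\<lambda>i. norm (\<alpha> i)) (B l) * w l" for l
    have g: "(g has_sum M) L"
    proof (rule has_sum_Sigma')
      show "((\<lambda>p. norm (\<alpha> (snd p)) * w (\<mu> (snd p))) has_sum M) (Sigma L B)"
        using summ by (rule regroup[THEN iffD1])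
      fix l assume "l \<in> L"
      have "((\<lambda>i. norm (\<alpha> i) * w l) has_sum g l) (B l)"
        unfolding g_def by (intro has_sum_cmult_left has_sum_infsum absB)
      then show "((\<lambda>i. norm (\<alpha> (snd (l, i))) * w (\<mu> (snd (l, i)))) has_sum g l) (B l)"
        by (subst has_sum_cong[where g = "\<lambda>i. norm (\<alpha> i) * w l"]) (auto simp: B_def)
    qed
    have le: "norm (c l) * w l \<le> g l" if "l \<in> L" for l
      unfolding g_def c_def using that
      by (intro mult_right_mono norm_infsum_bound absB weight_nonneg)
    have "(\<lambda>l. norm (c l) * w l) summable_on L"
      by (rule summable_on_comparison_test[OF has_sum_imp_summable[OF g] le])
        (auto simp: weight_nonneg)
    then have h: "((\<lambda>l. norm (c l) * w l) has_sum infsum (\<lambda>l. norm (c l) * w l) L) L"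
      by simp
    moreover have "infsum (\<lambda>l. norm (c l) * w l) L \<le> M"
      using has_sum_mono[OF h g le] .
    ultimately show ?thesis by blast
  qed
  ultimately show ?thesis unfolding rep_def by blast
qed

lemma rep_mono: "rep F M \<Longrightarrow> M \<le> M' \<Longrightarrow> rep F M'"
  unfolding rep_def by (meson order_trans)

lemma rep_cong: "rep F M \<Longrightarrow> (\<And>s. s \<in> Hr_closed \<Longrightarrow> F s = G s) \<Longrightarrow> rep G M"
  unfolding rep_def by (auto cong: ball_cong)

text \<open>Exponentials have modulus at most 1 there and weights are at least 1, so the weighted
  norm dominates the supremum norm.\<close>

lemma rep_norm_le:
  assumes "rep F M" "s \<in> Hr_closed"
  shows "norm (F s) \<le> M"
proof -
  from assms obtain a m where a: "m \<le> M" "((\<lambda>l. norm (a l) * w l) has_sum m) L"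
    "((\<lambda>l. a l * exp (- dotc l s)) has_sum F s) L"
    unfolding rep_def by blast
  have "norm (F s) \<le> m"
  proof (rule norm_infsum_le[OF a(3) a(2)])
    fix l assume l: "l \<in> L"
    have "norm (exp (- dotc l s)) \<le> w l"
      by (rule order_trans[OF norm_exp_dotc_le[OF l assms(2)] weight_ge_1[OF l]])
    then show "norm (a l * exp (- dotc l s)) \<le> norm (a l) * w l"
      unfolding norm_mult by (rule mult_left_mono) (rule norm_ge_zero)
  qed
  with a show ?thesis by simp
qed

lemma rep_const: "rep (\<lambda>_. c) (norm c)"
  by (rule rep_family[of "{()}" "\<lambda>_. 0" "\<lambda>_. c"])
    (auto simp: zero_mem weight_zero dotc_zero_left intro!: has_sum_finiteI)

text \<open>Completeness of the algebra, in the form used for Neumann series and expansions: the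
  coefficients of all terms form one summable family over \<open>UNIV \<times> L\<close>.\<close>

lemma rep_sums:
  assumes rep: "\<And>k::nat. rep (F k) (M k)" and M: "M sums m"
    and G: "\<And>s. s \<in> Hr_closed \<Longrightarrow> (\<lambda>k. F k s) sums G s"
  shows "rep G m"
proof -
  have "\<forall>k. \<exists>a n. n \<le> M k \<and> ((\<lambda>l. norm (a l) * w l) has_sum n) L \<and>
      (\<forall>s\<in>Hr_closed. ((\<lambda>l. a l * exp (- dotc l s)) has_sum F k s) L)"
    using rep unfolding rep_def by blast
  then obtain a n where an: "\<forall>k. n k \<le> M k \<and> ((\<lambda>l. norm (a k l) * w l) has_sum n k) L \<and>
      (\<forall>s\<in>Hr_closed. ((\<lambda>l. a k l * exp (- dotc l s)) has_sum F k s) L)"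
    by (auto dest!: choice)
  then have n: "\<And>k. n k \<le> M k"
    and a: "\<And>k. ((\<lambda>l. norm (a k l) * w l) has_sum n k) L"
    and F: "\<And>k s. s \<in> Hr_closed \<Longrightarrow> ((\<lambda>l. a k l * exp (- dotc l s)) has_sum F k s) L"
    by blast+
  \<comment> \<open>The double sum is evaluated with the exact norms \<open>n k\<close>, which are
    nonnegative and at most \<open>M k\<close>.\<close>
  have n0: "0 \<le> n k" for k
    using has_sum_nonneg[OF a[of k]] by (simp add: weight_nonneg)
  have sn: "summable n"
    by (rule summable_comparison_test_ev[OF _ sums_summable[OF M]]) (simp add: n n0)
  have nsum: "(n has_sum suminf n) UNIV"
    by (rule sums_nonneg_imp_has_sum) (auto simp: n0 sn summable_sums)
  have "(\<lambda>(k, l). norm (a k l) * w l) summable_on (UNIV \<times> L)"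
    by (rule summable_on_SigmaI[where g = n])
      (use a nsum in \<open>auto simp: weight_nonneg has_sum_imp_summable\<close>)
  then have sig: "((\<lambda>(k, l). norm (a k l) * w l) has_sum suminf n) (UNIV \<times> L)"
    by (intro has_sum_SigmaI[OF _ nsum]) (use a in auto)
  have "rep G (suminf n)"
  proof (rule rep_family[where \<mu> = snd and \<alpha> = "\<lambda>(k, l). a k l" and I = "UNIV \<times> L"])
    show "((\<lambda>i. norm (case i of (k, l) \<Rightarrow> a k l) * w (snd i)) has_sum suminf n) (UNIV \<times> L)"
      using sig by (simp add: case_prod_unfold)
    fix s :: "complex^'r" assume s: "s \<in> Hr_closed"
    have Fn: "norm (F k s) \<le> n k" for k
    proof -
      have "rep (F k) (n k)"
        by (rule rep_family[where \<mu> = id and I = L and \<alpha> = "a k"]) (use a F in auto)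
      then show ?thesis using rep_norm_le s by blast
    qed
    \<comment> \<open>The hypothesis gives convergence in the order of \<open>k\<close> only; the
      bound by \<open>n k\<close> makes it unconditional, as the double sum requires.\<close>
    have Gs: "((\<lambda>k. F k s) has_sum G s) UNIV"
      by (rule norm_summable_imp_has_sum[OF _ G[OF s]])
        (rule summable_comparison_test_ev[OF _ sn], simp add: Fn)
    have "(\<lambda>i. norm ((case i of (k, l) \<Rightarrow> a k l) * exp (- dotc (snd i) s))) summable_on (UNIV \<times> L)"
      by (rule summable_family[where \<mu> = snd])
        (use has_sum_imp_summable[OF sig] s norm_exp_dotc_le in \<open>auto simp: case_prod_unfold\<close>)
    then have "(\<lambda>i. (case i of (k, l) \<Rightarrow> a k l) * exp (- dotc (snd i) s)) summable_on (UNIV \<times> L)"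
      by (rule abs_summable_summable)
    then show "((\<lambda>i. (case i of (k, l) \<Rightarrow> a k l) * exp (- dotc (snd i) s)) has_sum G s) (UNIV \<times> L)"
      by (intro has_sum_SigmaI[OF _ Gs]) (use F s in auto)
  qed auto
  moreover have "suminf n \<le> m"
    using suminf_le[OF _ sn sums_summable[OF M]] n sums_unique[OF M] by simp
  ultimately show ?thesis by (rule rep_mono)
qed

section \<open>Sums, products and powers of representable functions\<close>

lemma rep_add:
  assumes "rep F M" "rep G N"
  shows "rep (\<lambda>s. F s + G s) (M + N)"
proof (rule rep_sums[where F = "\<lambda>k. if k = 0 then F else if k = 1 then G else (\<lambda>_. 0)"
      and M = "\<lambda>k. if k = 0 then M else if k = 1 then N else 0"])
  show "rep (if k = 0 then F else if k = 1 then G else (\<lambda>_. 0))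
    (if k = 0 then M else if k = 1 then N else 0)" for k :: nat
    using assms rep_const[of 0] by auto
  have "(\<lambda>k::nat. if k = 0 then M else if k = 1 then N else 0) sums
    (\<Sum>k\<in>{0,1::nat}. if k = 0 then M else if k = 1 then N else 0)"
    by (rule sums_finite) auto
  then show "(\<lambda>k::nat. if k = 0 then M else if k = 1 then N else 0) sums (M + N)" by simp
  fix s
  have "(\<lambda>k::nat. (if k = 0 then F else if k = 1 then G else (\<lambda>_. 0)) s) sums
    (\<Sum>k\<in>{0,1::nat}. (if k = 0 then F else if k = 1 then G else (\<lambda>_. 0)) s)"
    by (rule sums_finite) auto
  then show "(\<lambda>k::nat. (if k = 0 then F else if k = 1 then G else (\<lambda>_. 0)) s) sums (F s + G s)"
    by simp
qed

text \<open>The product is a family indexed by pairs, with frequencies \<open>fst p + snd p\<close>.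
  Merging it by \<open>rep_family\<close> is the convolution, and submultiplicativity of
  \<open>w\<close> bounds its norm.\<close>

lemma rep_mult:
  assumes "rep F M" "rep G N"
  shows "rep (\<lambda>s. F s * G s) (M * N)"
proof -
  obtain a m where m: "m \<le> M" and a: "((\<lambda>l. norm (a l) * w l) has_sum m) L"
    and F: "\<And>s. s \<in> Hr_closed \<Longrightarrow> ((\<lambda>l. a l * exp (- dotc l s)) has_sum F s) L"
    using assms(1) unfolding rep_def by blast
  obtain b n where n: "n \<le> N" and b: "((\<lambda>l. norm (b l) * w l) has_sum n) L"
    and G: "\<And>s. s \<in> Hr_closed \<Longrightarrow> ((\<lambda>l. b l * exp (- dotc l s)) has_sum G s) L"
    using assms(2) unfolding rep_def by blast
  have row: "((\<lambda>y. (norm (a x) * w x) * (norm (b y) * w y)) has_sum (norm (a x) * w x) * n) L" for x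
    by (intro has_sum_cmult_right b)
  have col: "((\<lambda>x. (norm (a x) * w x) * n) has_sum m * n) L"
    by (intro has_sum_cmult_left a)
  have summ: "(\<lambda>(x, y). (norm (a x) * w x) * (norm (b y) * w y)) summable_on (L \<times> L)"
    by (rule summable_on_SigmaI[where g = "\<lambda>x. (norm (a x) * w x) * n"])
      (use row col in \<open>auto simp: weight_nonneg has_sum_imp_summable\<close>)
  then have sig: "((\<lambda>(x, y). (norm (a x) * w x) * (norm (b y) * w y)) has_sum m * n) (L \<times> L)"
    by (intro has_sum_SigmaI[OF _ col]) (use row in auto)
  let ?\<alpha> = "\<lambda>p. a (fst p) * b (snd p)" and ?\<mu> = "\<lambda>p. fst p + snd p"
  have le: "norm (?\<alpha> p) * w (?\<mu> p) \<le> (case p of (x, y) \<Rightarrow> (norm (a x) * w x) * (norm (b y) * w y))"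
    if p: "p \<in> L \<times> L" for p
  proof -
    have "norm (?\<alpha> p) * w (?\<mu> p) \<le> norm (?\<alpha> p) * (w (fst p) * w (snd p))"
      using p by (intro mult_left_mono weight_add) auto
    then show ?thesis by (simp add: case_prod_unfold norm_mult mult_ac)
  qed
  have s1: "(\<lambda>p. norm (?\<alpha> p) * w (?\<mu> p)) summable_on (L \<times> L)"
    by (rule summable_on_comparison_test[OF summ le]) (auto intro!: mult_nonneg_nonneg weight_nonneg add_mem)
  have "rep (\<lambda>s. F s * G s) (infsum (\<lambda>p. norm (?\<alpha> p) * w (?\<mu> p)) (L \<times> L))"
  proof (rule rep_family)
    show "((\<lambda>p. norm (?\<alpha> p) * w (?\<mu> p)) has_sum infsum (\<lambda>p. norm (?\<alpha> p) * w (?\<mu> p)) (L \<times> L)) (L \<times> L)"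
      using s1 by simp
    show \<mu>: "?\<mu> p \<in> L" if "p \<in> L \<times> L" for p using that by (auto intro: add_mem)
    fix s :: "complex^'r" assume s: "s \<in> Hr_closed"
    let ?f = "\<lambda>p. (a (fst p) * b (snd p)) * exp (- dotc (fst p + snd p) s)"
    have "(\<lambda>p. norm (?f p)) summable_on (L \<times> L)"
      by (rule summable_family[OF \<mu> s1]) (use \<mu> norm_exp_dotc_le s in auto)
    then have "?f summable_on (L \<times> L)" by (rule abs_summable_summable)
    then show "(?f has_sum F s * G s) (L \<times> L)"
    proof (rule has_sum_SigmaI[rotated 2])
      show "((\<lambda>x. (a x * exp (- dotc x s)) * G s) has_sum F s * G s) L"
        by (intro has_sum_cmult_left F s)
      show "((\<lambda>y. ?f (x, y)) has_sum (a x * exp (- dotc x s)) * G s) L" for x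
      proof -
        have "((\<lambda>y. (a x * exp (- dotc x s)) * (b y * exp (- dotc y s))) has_sum
          (a x * exp (- dotc x s)) * G s) L"
          by (intro has_sum_cmult_right G s)
        then show ?thesis
          by (simp add: dotc_add_left exp_add exp_diff exp_minus field_simps)
      qed
    qed
  qed
  moreover have "infsum (\<lambda>p. norm (?\<alpha> p) * w (?\<mu> p)) (L \<times> L) \<le> m * n"
    using has_sum_mono[OF _ sig le] s1 by simp
  moreover have "m * n \<le> M * N"
    using m n has_sum_nonneg[OF a] has_sum_nonneg[OF b] 
    by (intro mult_mono) (auto simp: weight_nonneg intro: order_trans)
  ultimately show ?thesis using rep_mono by force
qed

lemma rep_cmult: "rep F M \<Longrightarrow> rep (\<lambda>s. c * F s) (norm c * M)"
  using rep_mult[OF rep_const] .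

lemma rep_sum:
  assumes "finite J" "\<And>j. j \<in> J \<Longrightarrow> rep (F j) (M j)"
  shows "rep (\<lambda>s. \<Sum>j\<in>J. F j s) (\<Sum>j\<in>J. M j)"
  using assms
proof (induction J rule: finite_induct)
  case empty
  then show ?case using rep_const[of 0] by simp
next
  case (insert j J)
  then show ?case using rep_add[of "F j" "M j"] by simp
qed

lemma rep_power: "rep F M \<Longrightarrow> rep (\<lambda>s. F s ^ k) (M ^ k)"
proof (induction k)
  case 0
  then show ?case using rep_const[of 1] by simp
next
  case (Suc k)
  then show ?case using rep_mult[of F M] by simp
qed

end

section \<open>The spectral radius\<close>

text \<open>Averaging over a translation by \<open>u\<close> with \<open>v \<bullet> u = pi\<close> removes the
  frequency \<open>v\<close> without changing the constant term.\<close>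

lemma constant_term_bound:
  fixes E :: "'a::real_inner set"
  assumes "finite E" "0 \<notin> E"
    and "\<And>t. norm (c0 + (\<Sum>v\<in>E. c v * cis (v \<bullet> t))) \<le> B"
  shows "norm c0 \<le> B"
  using assms
proof (induction E arbitrary: c rule: finite_induct)
  case empty
  then show ?case by simp
next
  case (insert v E)
  define u where "u = (pi / (v \<bullet> v)) *\<^sub>R v"
  have vu: "v \<bullet> u = pi"
    using insert.prems(1) by (auto simp: u_def)
  define g where "g t = c0 + (\<Sum>v\<in>insert v E. c v * cis (v \<bullet> t))" for t
  have g: "norm (g t) \<le> B" for t
    unfolding g_def by (rule insert.prems(2))
  \<comment> \<open>Averaging multiplies the coefficient of each remaining frequency
    \<open>x\<close> by \<open>(1 + cis (x \<bullet> u)) / 2\<close>, so the induction has to allow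
    arbitrary coefficients.\<close>
  have avg: "c0 + (\<Sum>x\<in>E. (c x * (1 + cis (x \<bullet> u)) / 2) * cis (x \<bullet> t)) = (g t + g (t + u)) / 2" for t
  proof -
    have "g t + g (t + u) = 2 * c0 + c v * (cis (v \<bullet> t) + cis (v \<bullet> t + pi))
        + (\<Sum>x\<in>E. c x * cis (x \<bullet> t) + c x * cis (x \<bullet> t + x \<bullet> u))"
      using insert.hyps by (simp add: g_def inner_add_right vu sum.distrib algebra_simps)
    also have "cis (v \<bullet> t) + cis (v \<bullet> t + pi) = 0"
      by (simp add: cis_mult[symmetric] del: cis_mult)
    finally have "(g t + g (t + u)) / 2 = c0 + (\<Sum>x\<in>E. c x * cis (x \<bullet> t) + c x * cis (x \<bullet> t + x \<bullet> u)) / 2"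
      by (simp add: field_simps)
    then show ?thesis
      by (simp add: sum_divide_distrib cis_mult[symmetric] algebra_simps add_divide_distrib)
  qed
  show ?case
  proof (rule insert.IH)
    show "0 \<notin> E" using insert.prems by auto
    fix t
    have "norm ((g t + g (t + u)) / 2) \<le> (norm (g t) + norm (g (t + u))) / 2"
      by (simp add: norm_divide norm_triangle_ineq)
    also have "\<dots> \<le> B" using g[of t] g[of "t + u"] by simp
    finally show "norm (c0 + (\<Sum>x\<in>E. (c x * (1 + cis (x \<bullet> u)) / 2) * cis (x \<bullet> t))) \<le> B"
      unfolding avg .
  qed
qed

text \<open>At purely imaginary points the sum is a trigonometric polynomial. Multiplication by the
  unimodular \<open>cis (- (x \<bullet> t))\<close> moves the frequency \<open>x\<close> to 0, so
  that its coefficient becomes the constant term.\<close>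

lemma coefficient_bound:
  fixes c :: "real^'r \<Rightarrow> complex"
  assumes E: "finite E" "x \<in> E"
    and bound: "\<And>s. s \<in> Hr_closed \<Longrightarrow> norm (\<Sum>v\<in>E. c v * exp (- dotc v s)) \<le> B"
  shows "norm (c x) \<le> B"
proof (rule constant_term_bound[where E = "(\<lambda>v. v - x) ` (E - {x})" and c = "\<lambda>v. c (v + x)"])
  show "finite ((\<lambda>v. v - x) ` (E - {x}))" "0 \<notin> (\<lambda>v. v - x) ` (E - {x})"
    using E by auto
  fix t :: "real^'r"
  define s :: "complex^'r" where "s = (\<chi> i. - (\<i> * of_real (t $ i)))"
  have ex: "exp (- dotc v s) = cis (v \<bullet> t)" for v
    by (simp add: s_def dotc_def inner_vec_def cis_conv_exp sum_distrib_left sum_negf mult_ac)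
  have "c x + (\<Sum>v\<in>(\<lambda>v. v - x) ` (E - {x}). c (v + x) * cis (v \<bullet> t))
      = c x * cis 0 + (\<Sum>v\<in>E - {x}. c v * cis ((v - x) \<bullet> t))"
    by (subst sum.reindex) (auto simp: inj_on_def)
  also have "\<dots> = (\<Sum>v\<in>E. c v * cis ((v - x) \<bullet> t))"
    using E by (simp add: sum.remove)
  also have "\<dots> = (\<Sum>v\<in>E. c v * exp (- dotc v s)) * cis (- (x \<bullet> t))"
    by (simp add: ex sum_distrib_right inner_diff_left cis_mult mult.assoc)
  finally have "norm (c x + (\<Sum>v\<in>(\<lambda>v. v - x) ` (E - {x}). c (v + x) * cis (v \<bullet> t)))
      = norm (\<Sum>v\<in>E. c v * exp (- dotc v s))"
    by (simp add: norm_mult)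
  also have "\<dots> \<le> B"
    by (rule bound) (simp add: Hr_closed_def s_def)
  finally show "norm (c x + (\<Sum>v\<in>(\<lambda>v. v - x) ` (E - {x}). c (v + x) * cis (v \<bullet> t))) \<le> B" .
qed

text \<open>The set \<open>E\<close> may exceed the image of \<open>\<mu>\<close>: frequencies that
  do not occur get the coefficient 0, an empty sum.\<close>

lemma collect_frequencies:
  assumes "finite I" "finite E" "\<mu> ` I \<subseteq> E"
  shows "\<exists>c. \<forall>s. (\<Sum>i\<in>I. \<alpha> i * exp (- dotc (\<mu> i) s)) = (\<Sum>v\<in>E. c v * exp (- dotc v s))"
proof (intro exI allI)
  fix s
  have "(\<Sum>i\<in>I. \<alpha> i * exp (- dotc (\<mu> i) s))
      = (\<Sum>v\<in>E. \<Sum>i\<in>{i \<in> I. \<mu> i = v}. \<alpha> i * exp (- dotc (\<mu> i) s))"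
    using assms by (subst sum.group) auto
  also have "\<dots> = (\<Sum>v\<in>E. (\<Sum>i\<in>{i \<in> I. \<mu> i = v}. \<alpha> i) * exp (- dotc v s))"
    by (intro sum.cong refl) (auto simp: sum_distrib_right intro!: sum.cong)
  finally show "(\<Sum>i\<in>I. \<alpha> i * exp (- dotc (\<mu> i) s))
      = (\<Sum>v\<in>E. (\<lambda>v. \<Sum>i\<in>{i \<in> I. \<mu> i = v}. \<alpha> i) v * exp (- dotc v s))" by simp
qed

text \<open>Large enough for all frequencies of the \<open>k\<close>-th power of an exponential
  polynomial supported on \<open>F\<close>. The multiplicities are bounded one by one instead of
  having sum \<open>k\<close>; the number of elements still grows only polynomially in
  \<open>k\<close>.\<close>

definition multiples :: "(real^'r) set \<Rightarrow> nat \<Rightarrow> (real^'r) set" where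
  "multiples F k = (\<lambda>g. \<Sum>l\<in>F. real (g l) *\<^sub>R l) ` (F \<rightarrow>\<^sub>E {..k})"

lemma
  assumes "finite F"
  shows finite_multiples: "finite (multiples F k)"
    and card_multiples_le: "card (multiples F k) \<le> Suc k ^ card F"
proof -
  have fin: "finite (F \<rightarrow>\<^sub>E {..k})" using assms by (intro finite_PiE) auto
  then show "finite (multiples F k)" by (simp add: multiples_def)
  have "card (multiples F k) \<le> card (F \<rightarrow>\<^sub>E {..k})"
    unfolding multiples_def by (rule card_image_le[OF fin])
  then show "card (multiples F k) \<le> Suc k ^ card F"
    using assms by (simp add: card_PiE)
qed

lemma multiplesI:
  assumes "\<And>l. l \<in> F \<Longrightarrow> g l \<le> k"
  shows "(\<Sum>l\<in>F. real (g l) *\<^sub>R l) \<in> multiples F k"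
proof -
  have "(\<Sum>l\<in>F. real (g l) *\<^sub>R l) = (\<Sum>l\<in>F. real (restrict g F l) *\<^sub>R l)"
    by (rule sum.cong) auto
  moreover have "restrict g F \<in> F \<rightarrow>\<^sub>E {..k}" using assms by auto
  ultimately show ?thesis unfolding multiples_def by blast
qed

lemma multiples_add:
  assumes "finite F" "v \<in> multiples F k" "x \<in> F"
  shows "v + x \<in> multiples F (Suc k)"
proof -
  obtain g where g: "g \<in> F \<rightarrow>\<^sub>E {..k}" "v = (\<Sum>l\<in>F. real (g l) *\<^sub>R l)"
    using assms unfolding multiples_def by auto
  define h where "h = g(x := Suc (g x))"
  have "(\<Sum>l\<in>F. real (h l) *\<^sub>R l) = (\<Sum>l\<in>F. real (g l) *\<^sub>R l + (if l = x then x else 0))"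
    by (rule sum.cong) (auto simp: h_def algebra_simps)
  also have "\<dots> = v + x"
    using assms by (simp add: sum.distrib g)
  finally have "v + x = (\<Sum>l\<in>F. real (h l) *\<^sub>R l)" by simp
  moreover have "h l \<le> Suc k" if "l \<in> F" for l
    using PiE_mem[OF g(1) that] PiE_mem[OF g(1) assms(3)] by (auto simp: h_def)
  ultimately show ?thesis using multiplesI[of F h "Suc k"] by simp
qed

lemma exp_polynomial_power:
  assumes F: "finite F"
  shows "\<exists>c. \<forall>s. (\<Sum>l\<in>F. a l * exp (- dotc l s)) ^ k = (\<Sum>v\<in>multiples F k. c v * exp (- dotc v s))"
proof (induction k)
  case 0
  have "\<exists>c. \<forall>s. (\<Sum>i\<in>{()}. 1 * exp (- dotc 0 s)) = (\<Sum>v\<in>multiples F 0. c v * exp (- dotc v s))"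
    using multiplesI[of F "\<lambda>_. 0" 0] by (intro collect_frequencies) (auto simp: finite_multiples F)
  then show ?case by (simp add: dotc_zero_left)
next
  case (Suc k)
  then obtain c where c: "\<And>s. (\<Sum>l\<in>F. a l * exp (- dotc l s)) ^ k = (\<Sum>v\<in>multiples F k. c v * exp (- dotc v s))"
    by blast
  have "(\<Sum>l\<in>F. a l * exp (- dotc l s)) ^ Suc k
      = (\<Sum>p\<in>multiples F k \<times> F. (c (fst p) * a (snd p)) * exp (- dotc (fst p + snd p) s))" for s
    unfolding power_Suc2 c sum_product sum.cartesian_product
    by (rule sum.cong) (auto simp: dotc_add_left exp_add exp_diff exp_minus field_simps)
  moreover have "\<exists>d. \<forall>s. (\<Sum>p\<in>multiples F k \<times> F. (c (fst p) * a (snd p)) * exp (- dotc (fst p + snd p) s))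
      = (\<Sum>v\<in>multiples F (Suc k). d v * exp (- dotc v s))"
    by (rule collect_frequencies) (auto simp: finite_multiples F multiples_add)
  ultimately show ?case by simp
qed

text \<open>Each induction step gives one \<open>sqrt q\<close> to the lower power and the other to
  a single linear factor, which Bernoulli's inequality bounds; hence the induction is over all
  \<open>q\<close>.\<close>

lemma Suc_power_le_exponential:
  fixes q :: real
  assumes "1 < q"
  shows "\<exists>C\<ge>0. \<forall>k. real (Suc k) ^ n \<le> C * q ^ k"
  using assms
proof (induction n arbitrary: q)
  case 0
  then show ?case by (intro exI[of _ 1]) (auto intro: one_le_power)
next
  case (Suc n)
  define x where "x = sqrt q - 1"
  have x: "x > 0" "1 < sqrt q" using Suc.prems by (auto simp: x_def)
  obtain C where C: "C \<ge> 0" "\<And>k. real (Suc k) ^ n \<le> C * sqrt q ^ k"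
    using Suc.IH[OF x(2)] by blast
  have lin: "real (Suc k) \<le> (1 + 1 / x) * sqrt q ^ k" for k
  proof -
    have "real (Suc k) \<le> (1 + 1 / x) * (1 + real k * x)"
      using x by (simp add: field_simps)
    also have "1 + real k * x \<le> (1 + x) ^ k"
      using x by (intro Bernoulli_inequality) auto
    finally show ?thesis using x by (simp add: x_def mult_left_mono)
  qed
  have "real (Suc k) ^ Suc n \<le> ((1 + 1 / x) * C) * q ^ k" for k
  proof -
    have "real (Suc k) ^ Suc n \<le> ((1 + 1 / x) * sqrt q ^ k) * (C * sqrt q ^ k)"
      unfolding power_Suc using x C by (intro mult_mono lin C) auto
    also have "\<dots> = ((1 + 1 / x) * C) * (sqrt q * sqrt q) ^ k"
      by (simp only: power_mult_distrib mult_ac)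
    finally show ?thesis using Suc.prems by simp
  qed
  moreover have "(1 + 1 / x) * C \<ge> 0" using x C by simp
  ultimately show ?case by blast
qed

context admissible_semigroup
begin

lemma scale_mem: "l \<in> L \<Longrightarrow> real n *\<^sub>R l \<in> L"
  by (induction n) (auto simp: zero_mem add_mem algebra_simps)

text \<open>The limit condition on \<open>w\<close> gives the bound with constant 1 beyond some
  \<open>N\<close>. The constant \<open>C\<close> adds up the finitely many weights up to
  \<open>N\<close>, and its summand 1 covers the rest.\<close>

lemma weight_multiple_le:
  assumes l: "l \<in> L" and q: "1 < q"
  shows "\<exists>C\<ge>0. \<forall>n. w (real n *\<^sub>R l) \<le> C * q ^ n"
proof -
  have "(\<lambda>n. w (real n *\<^sub>R l) powr (1 / real n)) \<longlonglongrightarrow> 1"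
    using admissible l by (simp add: admissible_weight_def)
  then have "\<forall>\<^sub>F n in sequentially. w (real n *\<^sub>R l) powr (1 / real n) < q"
    using q by (rule order_tendstoD)
  then obtain N where N: "\<And>n. n \<ge> N \<Longrightarrow> w (real n *\<^sub>R l) powr (1 / real n) < q"
    by (auto simp: eventually_sequentially)
  define C where "C = 1 + (\<Sum>n\<le>N. w (real n *\<^sub>R l))"
  have w1: "1 \<le> w (real n *\<^sub>R l)" for n
    using weight_ge_1 scale_mem l by blast
  have C1: "C \<ge> 1"
    unfolding C_def using weight_nonneg scale_mem l by (auto intro!: sum_nonneg)
  have "w (real n *\<^sub>R l) \<le> C * q ^ n" for n
  proof (cases "n \<le> N")
    case True
    have "w (real n *\<^sub>R l) \<le> (\<Sum>n\<le>N. w (real n *\<^sub>R l))"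
      using True w1 by (intro member_le_sum) (auto intro: order_trans[OF zero_le_one])
    also have "\<dots> \<le> C * 1" by (simp add: C_def)
    also have "\<dots> \<le> C * q ^ n"
      using C1 q by (intro mult_left_mono) (auto intro: one_le_power)
    finally show ?thesis .
  next
    case False
    then have n: "n > 0" "n \<ge> N" by auto
    have "w (real n *\<^sub>R l) = (w (real n *\<^sub>R l) powr (1 / real n)) ^ n"
      using n w1[of n] by (simp add: powr_power)
    also have "\<dots> \<le> 1 * q ^ n"
      using N[OF n(2)] by (auto intro!: power_mono)
    also have "\<dots> \<le> C * q ^ n"
      using C1 q by (intro mult_right_mono) auto
    finally show ?thesis .
  qed
  with C1 show ?thesis by (intro exI[of _ C]) auto
qed

lemma sum_multiples_mem:
  assumes "finite F" "F \<subseteq> L"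
  shows "(\<Sum>l\<in>F. real (g l) *\<^sub>R l) \<in> L"
  using assms by (induction F rule: finite_induct) (auto simp: zero_mem add_mem scale_mem)

text \<open>Submultiplicativity separates the elements of \<open>F\<close>. Each induction step
  spends \<open>sqrt q\<close> on the new element and leaves \<open>sqrt q\<close> for the
  others.\<close>

lemma weight_sum_multiples_le:
  assumes "finite F" "F \<subseteq> L" "1 < q"
  shows "\<exists>D\<ge>0. \<forall>k g. (\<forall>l\<in>F. g l \<le> k) \<longrightarrow> w (\<Sum>l\<in>F. real (g l) *\<^sub>R l) \<le> D * q ^ k"
  using assms
proof (induction F arbitrary: q rule: finite_induct)
  case empty
  then show ?case by (intro exI[of _ 1]) (auto simp: weight_zero intro: one_le_power)
next
  case (insert x F)
  have r: "1 < sqrt q" using insert.prems by simp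
  obtain D where D: "D \<ge> 0"
    "\<And>k g. (\<forall>l\<in>F. g l \<le> k) \<Longrightarrow> w (\<Sum>l\<in>F. real (g l) *\<^sub>R l) \<le> D * sqrt q ^ k"
    using insert.IH[OF _ r] insert.prems by auto
  obtain C where C: "C \<ge> 0" "\<And>n. w (real n *\<^sub>R x) \<le> C * sqrt q ^ n"
    using weight_multiple_le[of x, OF _ r] insert.prems by blast
  have "w (\<Sum>l\<in>insert x F. real (g l) *\<^sub>R l) \<le> (C * D) * q ^ k" if g: "\<forall>l\<in>insert x F. g l \<le> k" for g k
  proof -
    have "w (\<Sum>l\<in>insert x F. real (g l) *\<^sub>R l)
        \<le> w (real (g x) *\<^sub>R x) * w (\<Sum>l\<in>F. real (g l) *\<^sub>R l)"
      using insert by (simp add: weight_add scale_mem sum_multiples_mem)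
    also have "\<dots> \<le> (C * sqrt q ^ g x) * (D * sqrt q ^ k)"
      using g insert C D by (intro mult_mono) (auto intro!: weight_nonneg sum_multiples_mem)
    also have "\<dots> \<le> (C * sqrt q ^ k) * (D * sqrt q ^ k)"
      using g C D r by (intro mult_right_mono mult_left_mono power_increasing) auto
    also have "\<dots> = (C * D) * (sqrt q * sqrt q) ^ k"
      by (simp only: power_mult_distrib mult_ac)
    finally show ?thesis using insert.prems by simp
  qed
  moreover have "C * D \<ge> 0" using C D by simp
  ultimately show ?case by blast
qed

lemma rep_exp_polynomial:
  assumes "finite E" "E \<subseteq> L"
  shows "rep (\<lambda>s. \<Sum>l\<in>E. a l * exp (- dotc l s)) (\<Sum>l\<in>E. norm (a l) * w l)"
  by (rule rep_family[where I = E and \<mu> = id and \<alpha> = a]) (use assms in auto)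

lemma rep_powers_exp_polynomial:
  fixes a :: "real^'r \<Rightarrow> complex"
  defines "P \<equiv> \<lambda>F s. \<Sum>l\<in>F. a l * exp (- dotc l s)"
  assumes F: "finite F" "F \<subseteq> L"
    and bound: "\<And>s. s \<in> Hr_closed \<Longrightarrow> norm (P F s) \<le> \<sigma>"
    and q: "\<sigma> < q"
  shows "\<exists>C\<ge>0. \<forall>k. rep (\<lambda>s. P F s ^ k) (C * q ^ k)"
proof -
  \<comment> \<open>The midpoint is positive even when \<open>\<sigma>\<close> is 0, so it can be
    divided by. The slack left is \<open>q = \<tau> * (r * r)\<close>: one \<open>r ^ k\<close> pays
    for the number of frequencies, the other for their weights.\<close>
  define \<tau> where "\<tau> = (\<sigma> + q) / 2"
  have "\<sigma> \<ge> 0" using order_trans[OF norm_ge_zero bound[of 0]] by (simp add: Hr_closed_def)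
  then have \<tau>: "0 < \<tau>" "\<sigma> \<le> \<tau>" "\<tau> < q" using q by (auto simp: \<tau>_def)
  define r where "r = sqrt (q / \<tau>)"
  have r: "1 < r" using \<tau> by (simp add: r_def)
  have r2: "\<tau> * (r * r) = q" using \<tau> by (simp add: r_def)
  obtain D where D: "D \<ge> 0"
    "\<And>k g. (\<forall>l\<in>F. g l \<le> k) \<Longrightarrow> w (\<Sum>l\<in>F. real (g l) *\<^sub>R l) \<le> D * r ^ k"
    using weight_sum_multiples_le[OF F r] by blast
  obtain C where C: "C \<ge> 0" "\<And>k. real (Suc k) ^ card F \<le> C * r ^ k"
    using Suc_power_le_exponential[OF r] by blast
  have "rep (\<lambda>s. P F s ^ k) ((C * D) * q ^ k)" for k
  proof -
    obtain c where c: "\<And>s. P F s ^ k = (\<Sum>v\<in>multiples F k. c v * exp (- dotc v s))"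
      using exp_polynomial_power[OF F(1)] unfolding P_def by blast
    have mem: "v \<in> L" "w v \<le> D * r ^ k" if "v \<in> multiples F k" for v
      using that sum_multiples_mem[OF F] D(2) unfolding multiples_def by (auto simp: PiE_iff)
    have cb: "norm (c v) \<le> \<tau> ^ k" if "v \<in> multiples F k" for v
    proof (rule coefficient_bound[OF finite_multiples[OF F(1)] that])
      fix s :: "complex^'r" assume s: "s \<in> Hr_closed"
      show "norm (\<Sum>v\<in>multiples F k. c v * exp (- dotc v s)) \<le> \<tau> ^ k"
        unfolding c[symmetric] norm_power
        by (rule power_mono) (use bound[OF s] \<tau> in auto)
    qed
    have "rep (\<lambda>s. P F s ^ k) (\<Sum>v\<in>multiples F k. norm (c v) * w v)"
      unfolding c by (rule rep_exp_polynomial) (auto simp: finite_multiples F mem)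
    moreover have "(\<Sum>v\<in>multiples F k. norm (c v) * w v) \<le> (C * D) * q ^ k"
    proof -
      have "(\<Sum>v\<in>multiples F k. norm (c v) * w v) \<le> real (card (multiples F k)) * (\<tau> ^ k * (D * r ^ k))"
        using \<tau> by (intro sum_bounded_above mult_mono cb mem) (auto intro: weight_nonneg mem)
      also have "\<dots> \<le> (C * r ^ k) * (\<tau> ^ k * (D * r ^ k))"
      proof (rule mult_right_mono)
        have "real (card (multiples F k)) \<le> real (Suc k ^ card F)"
          using card_multiples_le[OF F(1)] by (simp only: of_nat_le_iff)
        then show "real (card (multiples F k)) \<le> C * r ^ k" using C(2)[of k] by simp
      qed (use \<tau> D r in auto)
      also have "\<dots> = (C * D) * (\<tau> * (r * r)) ^ k"
        by (simp add: power_mult_distrib)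
      finally show ?thesis unfolding r2 .
    qed
    ultimately show ?thesis by (rule rep_mono)
  qed
  with C D show ?thesis by (intro exI[of _ "C * D"]) auto
qed

text \<open>Density of the finitely supported elements: the difference has its coefficients on
  \<open>L - E\<close>, and its norm is the tail of the series for \<open>m\<close>.\<close>

lemma rep_approx:
  assumes "rep F M" "0 < \<epsilon>"
  obtains E a where "finite E" "E \<subseteq> L"
    "rep (\<lambda>s. F s - (\<Sum>l\<in>E. a l * exp (- dotc l s))) \<epsilon>"
proof -
  obtain a m where a: "((\<lambda>l. norm (a l) * w l) has_sum m) L"
    and F: "\<And>s. s \<in> Hr_closed \<Longrightarrow> ((\<lambda>l. a l * exp (- dotc l s)) has_sum F s) L"
    using assms(1) unfolding rep_def by blast
  obtain E where E: "finite E" "E \<subseteq> L" "dist (\<Sum>l\<in>E. norm (a l) * w l) m \<le> \<epsilon>"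
    using has_sum_finite_approximation[OF a assms(2)] by blast
  have "rep (\<lambda>s. F s - (\<Sum>l\<in>E. a l * exp (- dotc l s))) (m - (\<Sum>l\<in>E. norm (a l) * w l))"
  proof (rule rep_family[where I = "L - E" and \<mu> = id and \<alpha> = a])
    show "((\<lambda>i. norm (a i) * w (id i)) has_sum m - (\<Sum>l\<in>E. norm (a l) * w l)) (L - E)"
      using has_sum_Diff[OF a has_sum_finite[OF E(1)] E(2)] by simp
    show "((\<lambda>i. a i * exp (- dotc (id i) s)) has_sum F s - (\<Sum>l\<in>E. a l * exp (- dotc l s))) (L - E)"
      if "s \<in> Hr_closed" for s
      using has_sum_Diff[OF F[OF that] has_sum_finite[OF E(1)] E(2)] by simp
  qed auto
  moreover have "m - (\<Sum>l\<in>E. norm (a l) * w l) \<le> \<epsilon>"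
    using E(3) by (simp add: dist_real_def)
  ultimately show ?thesis using that[OF E(1,2)] rep_mono by blast
qed

text \<open>The gap between \<open>\<sigma>\<close> and \<open>q\<close> is cut into three. The
  finite part is bounded by \<open>\<sigma> + \<epsilon>\<close>, the norms of its powers grow at
  most like those of \<open>\<sigma> + 2 * \<epsilon>\<close>, and the binomial theorem with a
  remainder of norm \<open>\<epsilon>\<close> yields \<open>q\<close>.\<close>

lemma rep_powers:
  assumes F: "rep F M" and bound: "\<And>s. s \<in> Hr_closed \<Longrightarrow> norm (F s) \<le> \<sigma>"
    and q: "\<sigma> < q"
  shows "\<exists>C\<ge>0. \<forall>k. rep (\<lambda>s. F s ^ k) (C * q ^ k)"
proof -
  define \<epsilon> where "\<epsilon> = (q - \<sigma>) / 3"
  have \<epsilon>: "0 < \<epsilon>" using q by (simp add: \<epsilon>_def)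
  obtain E a where E: "finite E" "E \<subseteq> L"
    and R: "rep (\<lambda>s. F s - (\<Sum>l\<in>E. a l * exp (- dotc l s))) \<epsilon>"
    by (rule rep_approx[OF F \<epsilon>])
  let ?P = "\<lambda>s. \<Sum>l\<in>E. a l * exp (- dotc l s)"
  let ?R = "\<lambda>s. F s - ?P s"
  have "norm (?P s) \<le> \<sigma> + \<epsilon>" if "s \<in> Hr_closed" for s
    using rep_norm_le[OF R that] bound[OF that] norm_triangle_ineq4[of "F s" "?R s"] by simp
  then obtain C where C: "C \<ge> 0" "\<And>k. rep (\<lambda>s. ?P s ^ k) (C * (\<sigma> + 2 * \<epsilon>) ^ k)"
    using rep_powers_exp_polynomial[OF E, of a "\<sigma> + \<epsilon>" "\<sigma> + 2 * \<epsilon>"] \<epsilon> by auto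
  have "rep (\<lambda>s. F s ^ k) (C * q ^ k)" for k
  proof -
    have "rep (\<lambda>s. \<Sum>j\<le>k. of_nat (k choose j) * (?P s ^ j * ?R s ^ (k - j)))
      (\<Sum>j\<le>k. norm (of_nat (k choose j) :: complex) * ((C * (\<sigma> + 2 * \<epsilon>) ^ j) * \<epsilon> ^ (k - j)))"
      by (intro rep_sum rep_cmult rep_mult C rep_power R) auto
    moreover have "(\<Sum>j\<le>k. of_nat (k choose j) * (?P s ^ j * ?R s ^ (k - j))) = F s ^ k" for s
      using binomial_ring[of "?P s" "?R s" k] by (simp add: mult.assoc)
    moreover have "(\<Sum>j\<le>k. norm (of_nat (k choose j) :: complex) * ((C * (\<sigma> + 2 * \<epsilon>) ^ j) * \<epsilon> ^ (k - j)))
        = C * ((\<sigma> + 2 * \<epsilon>) + \<epsilon>) ^ k"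
      unfolding binomial_ring by (simp add: sum_distrib_left mult_ac)
    moreover have "(\<sigma> + 2 * \<epsilon>) + \<epsilon> = q" by (simp add: \<epsilon>_def field_simps)
    ultimately show ?thesis by simp
  qed
  with C(1) show ?thesis by blast
qed

end

section \<open>Inversion\<close>

text \<open>The decay rate of the exponential with frequency \<open>l\<close> along the diagonal
  translation \<open>shift\<close>.\<close>

definition coord_sum :: "real^'r \<Rightarrow> real" where
  "coord_sum l = (\<Sum>i\<in>UNIV. l $ i)"

definition shift :: "real \<Rightarrow> complex^'r \<Rightarrow> complex^'r" where
  "shift t s = s + (\<chi> i. of_real t)"

lemma shift_0 [simp]: "shift 0 s = s"
  by (simp add: shift_def vec_eq_iff)

lemma shift_Hr_closed: "s \<in> Hr_closed \<Longrightarrow> 0 \<le> t \<Longrightarrow> shift t s \<in> Hr_closed"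
  by (simp add: shift_def Hr_closed_def)

lemma shift_Hr: "s \<in> Hr_closed \<Longrightarrow> 0 < t \<Longrightarrow> shift t s \<in> Hr"
  by (auto simp: shift_def Hr_closed_def Hr_def intro: add_nonneg_pos)

lemma exp_dotc_shift:
  "exp (- dotc l (shift t s)) = of_real (exp (- t * coord_sum l)) * exp (- dotc l s)"
proof -
  have "dotc l (shift t s) = dotc l s + of_real (t * coord_sum l)"
    by (simp add: shift_def dotc_add_right) (simp add: dotc_def coord_sum_def sum_distrib_left mult.commute)
  then show ?thesis
    by (simp add: exp_of_real[symmetric] exp_add[symmetric] algebra_simps)
qed

lemma exp_neg_diff_le:
  fixes x :: real
  assumes "0 \<le> x" "0 \<le> y"
  shows "\<bar>exp (- x) - exp (- y)\<bar> \<le> \<bar>x - y\<bar>"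
proof -
  have *: "exp (- x) - exp (- y) \<le> y - x" if "0 \<le> x" "x \<le> y" for x y :: real
  proof -
    have "exp (- x) - exp (- y) = exp (- x) * (1 - exp (- (y - x)))"
      by (simp add: algebra_simps exp_add[symmetric])
    also have "\<dots> \<le> 1 * (1 - exp (- (y - x)))"
      using that by (intro mult_right_mono) auto
    also have "\<dots> \<le> y - x"
      using exp_ge_add_one_self[of "- (y - x)"] by (simp only: mult_1_left)
    finally show ?thesis .
  qed
  show ?thesis
    using *[of x y] *[of y x] assms by (cases "x \<le> y") auto
qed

section \<open>Diagonal translations and Neumann steps\<close>

context admissible_semigroup
begin

lemma coord_sum_nonneg: "l \<in> L \<Longrightarrow> 0 \<le> coord_sum l"
  unfolding coord_sum_def by (intro sum_nonneg nonneg_mem)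

text \<open>Coordinates in \<open>L\<close> cannot cancel, being nonnegative. Hence only the
  frequency 0 survives a translation to infinity.\<close>

lemma coord_sum_pos:
  assumes "l \<in> L" "l \<noteq> 0"
  shows "0 < coord_sum l"
proof -
  obtain i where "l $ i \<noteq> 0" using assms(2) by (auto simp: vec_eq_iff)
  then show ?thesis
    unfolding coord_sum_def using assms(1) nonneg_mem[OF assms(1)] by (intro sum_pos2[where i = i]) (auto simp: less_le)
qed

text \<open>The translation multiplies each coefficient on \<open>L\<close> by a factor between 0
  and 1, because \<open>coord_sum\<close> is nonnegative there.\<close>

lemma rep_shift:
  assumes "rep F M" "0 \<le> t"
  shows "rep (\<lambda>s. F (shift t s)) M"
proof -
  obtain a m where m: "m \<le> M" and a: "((\<lambda>l. norm (a l) * w l) has_sum m) L"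
    and F: "\<And>s. s \<in> Hr_closed \<Longrightarrow> ((\<lambda>l. a l * exp (- dotc l s)) has_sum F s) L"
    using assms(1) unfolding rep_def by blast
  define b :: "real^'r \<Rightarrow> complex" where "b l = a l * of_real (exp (- t * coord_sum l))" for l
  have le: "norm (b l) * w l \<le> norm (a l) * w l" if "l \<in> L" for l
  proof (rule mult_right_mono)
    have "norm (b l) = norm (a l) * exp (- t * coord_sum l)"
      by (simp add: b_def norm_mult)
    also have "\<dots> \<le> norm (a l) * 1"
      using coord_sum_nonneg[OF that] assms(2) by (intro mult_left_mono) auto
    finally show "norm (b l) \<le> norm (a l)" by simp
  qed (use that weight_nonneg in auto)
  have "(\<lambda>l. norm (b l) * w l) summable_on L"
    by (rule summable_on_comparison_test[OF has_sum_imp_summable[OF a] le]) (auto simp: weight_nonneg)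
  then have b: "((\<lambda>l. norm (b l) * w l) has_sum infsum (\<lambda>l. norm (b l) * w l) L) L"
    by simp
  have "rep (\<lambda>s. F (shift t s)) (infsum (\<lambda>l. norm (b l) * w l) L)"
  proof (rule rep_family[where I = L and \<mu> = id and \<alpha> = b])
    fix s :: "complex^'r" assume "s \<in> Hr_closed"
    then show "((\<lambda>l. b l * exp (- dotc (id l) s)) has_sum F (shift t s)) L"
      using F[OF shift_Hr_closed] assms(2) by (simp add: b_def exp_dotc_shift mult.assoc)
  qed (use b in auto)
  moreover have "infsum (\<lambda>l. norm (b l) * w l) L \<le> m"
    using has_sum_mono[OF b a le] .
  ultimately show ?thesis using m rep_mono by force
qed

lemma rep_diff: "rep F M \<Longrightarrow> rep G N \<Longrightarrow> rep (\<lambda>s. F s - G s) (M + N)"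
  using rep_add[of F M "\<lambda>s. (-1) * G s" "norm (-1::complex) * N"] rep_cmult[of G N "-1"] by simp

text \<open>The finite part is Lipschitz in \<open>t\<close> by \<open>exp_neg_diff_le\<close>, and
  the remainder is small both at \<open>t\<close> and at \<open>u\<close>; these are the three
  shares of \<open>\<epsilon>\<close>.\<close>

lemma rep_shift_uniform:
  assumes F: "rep F M" and \<epsilon>: "0 < \<epsilon>"
  shows "\<exists>\<eta>>0. \<forall>t\<ge>0. \<forall>u\<ge>0. \<bar>t - u\<bar> \<le> \<eta> \<longrightarrow> rep (\<lambda>s. F (shift t s) - F (shift u s)) \<epsilon>"
proof -
  define \<delta> where "\<delta> = \<epsilon> / 3"
  have \<delta>: "0 < \<delta>" using \<epsilon> by (simp add: \<delta>_def)
  obtain E a where E: "finite E" "E \<subseteq> L"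
    and R: "rep (\<lambda>s. F s - (\<Sum>l\<in>E. a l * exp (- dotc l s))) \<delta>"
    by (rule rep_approx[OF F \<delta>])
  let ?P = "\<lambda>s. \<Sum>l\<in>E. a l * exp (- dotc l s)"
  let ?R = "\<lambda>s. F s - ?P s"
  \<comment> \<open>A Lipschitz constant of the finite part in the weighted norm; adding 1 to it in
    \<open>\<eta>\<close> avoids division by 0.\<close>
  define S where "S = (\<Sum>l\<in>E. norm (a l) * coord_sum l * w l)"
  have S: "S \<ge> 0"
    unfolding S_def using E(2) by (auto intro!: sum_nonneg mult_nonneg_nonneg coord_sum_nonneg weight_nonneg)
  define \<eta> where "\<eta> = \<delta> / (S + 1)"
  have \<eta>: "\<eta> > 0" "\<eta> * S \<le> \<delta>"
    using S \<delta> by (auto simp: \<eta>_def field_simps)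
  have "rep (\<lambda>s. F (shift t s) - F (shift u s)) \<epsilon>" if tu: "0 \<le> t" "0 \<le> u" "\<bar>t - u\<bar> \<le> \<eta>" for t u
  proof -
    let ?e = "\<lambda>l. exp (- t * coord_sum l) - exp (- u * coord_sum l)"
    have "rep (\<lambda>s. \<Sum>l\<in>E. (a l * of_real (?e l)) * exp (- dotc l s))
        (\<Sum>l\<in>E. norm (a l * of_real (?e l)) * w l)"
      by (rule rep_exp_polynomial[OF E])
    moreover have "(\<Sum>l\<in>E. norm (a l * of_real (?e l)) * w l) \<le> \<delta>"
    proof -
      have "(\<Sum>l\<in>E. norm (a l * of_real (?e l)) * w l)
          \<le> (\<Sum>l\<in>E. \<eta> * (norm (a l) * coord_sum l * w l))"
      proof (rule sum_mono)
        fix l assume "l \<in> E"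
        then have l: "l \<in> L" using E by auto
        define x where "x = coord_sum l"
        have x: "x \<ge> 0" unfolding x_def by (rule coord_sum_nonneg[OF l])
        have "\<bar>exp (- (t * x)) - exp (- (u * x))\<bar> \<le> \<bar>t * x - u * x\<bar>"
          using x tu by (intro exp_neg_diff_le) auto
        also have "\<dots> = \<bar>t - u\<bar> * x"
          using x by (simp add: left_diff_distrib[symmetric] abs_mult)
        also have "\<dots> \<le> \<eta> * x"
          using x tu by (intro mult_right_mono) auto
        finally have "\<bar>?e l\<bar> \<le> \<eta> * x" by (simp add: x_def)
        then have "norm (a l * of_real (?e l)) * w l \<le> (norm (a l) * (\<eta> * x)) * w l"
          unfolding norm_mult norm_of_real using weight_nonneg[OF l]
          by (intro mult_right_mono mult_left_mono) auto
        then show "norm (a l * of_real (?e l)) * w l \<le> \<eta> * (norm (a l) * coord_sum l * w l)"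
          by (simp add: x_def mult_ac)
      qed
      also have "\<dots> = \<eta> * S" by (simp add: S_def sum_distrib_left)
      finally show ?thesis using \<eta> by simp
    qed
    ultimately have "rep (\<lambda>s. \<Sum>l\<in>E. (a l * of_real (?e l)) * exp (- dotc l s)) \<delta>"
      by (rule rep_mono)
    moreover have "(\<Sum>l\<in>E. (a l * of_real (?e l)) * exp (- dotc l s)) = ?P (shift t s) - ?P (shift u s)" for s
      by (simp add: exp_dotc_shift sum_subtractf[symmetric] algebra_simps)
    ultimately have P: "rep (\<lambda>s. ?P (shift t s) - ?P (shift u s)) \<delta>"
      by simp
    have "rep (\<lambda>s. (?P (shift t s) - ?P (shift u s)) + (?R (shift t s) - ?R (shift u s))) (\<delta> + (\<delta> + \<delta>))"
      by (intro rep_add P rep_diff rep_shift[OF R] tu)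
    then show ?thesis by (simp add: \<delta>_def)
  qed
  with \<eta>(1) show ?thesis by blast
qed

lemma rep_shift_at_infinity:
  assumes F: "rep F M" and \<epsilon>: "0 < \<epsilon>"
  shows "\<exists>c. \<exists>T\<ge>0. rep (\<lambda>s. F (shift T s) - c) \<epsilon>"
proof -
  define \<delta> where "\<delta> = \<epsilon> / 2"
  have \<delta>: "0 < \<delta>" using \<epsilon> by (simp add: \<delta>_def)
  obtain E a where E: "finite E" "E \<subseteq> L"
    and R: "rep (\<lambda>s. F s - (\<Sum>l\<in>E. a l * exp (- dotc l s))) \<delta>"
    by (rule rep_approx[OF F \<delta>])
  let ?P = "\<lambda>s. \<Sum>l\<in>E. a l * exp (- dotc l s)"
  let ?R = "\<lambda>s. F s - ?P s"
  \<comment> \<open>This is \<open>a 0\<close> or 0, according to whether 0 belongs to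
    \<open>E\<close>: the part of the sum that translation leaves unchanged.\<close>
  define c where "c = (\<Sum>l\<in>E \<inter> {0}. a l)"
  let ?b = "\<lambda>T l. a l * of_real (exp (- T * coord_sum l))"
  have "((\<lambda>T. \<Sum>l\<in>E - {0}. norm (?b T l) * w l) \<longlongrightarrow> (\<Sum>l\<in>E - {0}. norm (a l) * 0 * w l)) at_top"
  proof (intro tendsto_sum)
    fix l assume "l \<in> E - {0}"
    then have pos: "0 < coord_sum l" using coord_sum_pos E by blast
    have "((\<lambda>T. exp (coord_sum l * - T)) \<longlongrightarrow> 0) at_top"
      by (rule filterlim_compose[OF exp_at_bot],
          rule filterlim_tendsto_pos_mult_at_bot[OF tendsto_const pos filterlim_uminus_at_bot_at_top])
    then have "((\<lambda>T. exp (- T * coord_sum l)) \<longlongrightarrow> 0) at_top"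
      by (simp add: mult.commute)
    then have "((\<lambda>T. norm (a l) * exp (- T * coord_sum l) * w l) \<longlongrightarrow> norm (a l) * 0 * w l) at_top"
      by (intro tendsto_intros)
    then show "((\<lambda>T. norm (?b T l) * w l) \<longlongrightarrow> norm (a l) * 0 * w l) at_top"
      by (simp add: norm_mult)
  qed
  then have "\<forall>\<^sub>F T in at_top. (\<Sum>l\<in>E - {0}. norm (?b T l) * w l) < \<delta>"
    using \<delta> by (intro order_tendstoD(2)) auto
  then obtain T0 where T0: "\<And>T. T \<ge> T0 \<Longrightarrow> (\<Sum>l\<in>E - {0}. norm (?b T l) * w l) < \<delta>"
    by (auto simp: eventually_at_top_linorder)
  define T where "T = max T0 0"
  have T: "0 \<le> T" "(\<Sum>l\<in>E - {0}. norm (?b T l) * w l) \<le> \<delta>"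
    using T0[of T] by (auto simp: T_def)
  have P: "?P (shift T s) - c = (\<Sum>l\<in>E - {0}. ?b T l * exp (- dotc l s))" for s
  proof -
    have "?P (shift T s) = (\<Sum>l\<in>E. ?b T l * exp (- dotc l s))"
      by (simp add: exp_dotc_shift mult.assoc)
    also have "\<dots> = (\<Sum>l\<in>E - {0}. ?b T l * exp (- dotc l s)) + (\<Sum>l\<in>E \<inter> {0}. ?b T l * exp (- dotc l s))"
      using sum.Int_Diff[OF E(1), of "\<lambda>l. ?b T l * exp (- dotc l s)" "{0}"] by (simp only: add.commute)
    also have "(\<Sum>l\<in>E \<inter> {0}. ?b T l * exp (- dotc l s)) = c"
      unfolding c_def by (rule sum.cong) (auto simp: dotc_zero_left coord_sum_def)
    finally show ?thesis by simp
  qed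
  have "rep (\<lambda>s. (?P (shift T s) - c) + ?R (shift T s)) (\<delta> + \<delta>)"
  proof (intro rep_add rep_shift[OF R] T)
    show "rep (\<lambda>s. ?P (shift T s) - c) \<delta>"
      unfolding P by (rule rep_mono[OF rep_exp_polynomial T(2)]) (use E in auto)
  qed
  then have "rep (\<lambda>s. F (shift T s) - c) \<epsilon>" by (simp add: \<delta>_def)
  with T(1) show ?thesis by blast
qed

text \<open>A small diagonal translation moves the closed half space into the open one and changes
  \<open>F\<close> little. So an assumption on the range over \<open>Hr\<close> controls the values
  over \<open>Hr_closed\<close>.\<close>

lemma rep_in_closure:
  assumes F: "rep F M" and s: "s \<in> Hr_closed"
  shows "F s \<in> closure (F ` Hr)"
  unfolding closure_approachable
proof (intro allI impI)
  fix e :: real assume e: "0 < e"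
  obtain \<eta> where \<eta>: "\<eta> > 0"
    "\<And>t u. 0 \<le> t \<Longrightarrow> 0 \<le> u \<Longrightarrow> \<bar>t - u\<bar> \<le> \<eta> \<Longrightarrow> rep (\<lambda>s. F (shift t s) - F (shift u s)) (e / 2)"
    using rep_shift_uniform[OF F half_gt_zero[OF e]] by blast
  have "rep (\<lambda>s. F (shift \<eta> s) - F (shift 0 s)) (e / 2)"
    by (rule \<eta>(2)) (use \<eta>(1) in auto)
  then have "norm (F (shift \<eta> s) - F (shift 0 s)) \<le> e / 2"
    using s by (rule rep_norm_le)
  then show "\<exists>y\<in>F ` Hr. dist y (F s) < e"
    using shift_Hr[OF s \<eta>(1)] e by (auto simp: dist_norm intro!: bexI[of _ "shift \<eta> s"])
qed

text \<open>By \<open>rep_powers\<close> with some \<open>q < 1\<close>, the Neumann series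
  converges in the weighted norm although only the supremum norm is known to be below 1.\<close>

lemma rep_inverse_one_minus:
  assumes F: "rep F M" and bound: "\<And>s. s \<in> Hr_closed \<Longrightarrow> norm (F s) \<le> \<sigma>" and \<sigma>: "\<sigma> < 1"
  shows "\<exists>N. rep (\<lambda>s. 1 / (1 - F s)) N"
proof -
  obtain q where q: "\<sigma> < q" "q < 1" using \<sigma> dense by blast
  have "0 \<le> \<sigma>" using order_trans[OF norm_ge_zero bound[of 0]] by (simp add: Hr_closed_def)
  obtain C where C: "\<And>k. rep (\<lambda>s. F s ^ k) (C * q ^ k)"
    using rep_powers[OF F bound q(1)] by blast
  have "rep (\<lambda>s. 1 / (1 - F s)) (C * (1 / (1 - q)))"
  proof (rule rep_sums[OF C])
    show "(\<lambda>k. C * q ^ k) sums (C * (1 / (1 - q)))"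
      using q \<open>0 \<le> \<sigma>\<close> by (intro sums_mult geometric_sums) auto
    show "(\<lambda>k. F s ^ k) sums (1 / (1 - F s))" if "s \<in> Hr_closed" for s
      using bound[OF that] \<sigma> by (intro geometric_sums) auto
  qed
  then show ?thesis by blast
qed

text \<open>Write \<open>1 / V\<close> as \<open>1 / U\<close> times
  \<open>1 / (1 - (U - V) / U)\<close>. Smallness is measured pointwise, so the norm
  \<open>K\<close> of the known inverse does not limit the step; this allows steps of fixed length
  in \<open>rep_inverse\<close>.\<close>

lemma rep_inverse_perturb:
  assumes U: "rep U M" and V: "rep V N" and invU: "rep (\<lambda>s. 1 / U s) K"
    and U0: "\<And>s. s \<in> Hr_closed \<Longrightarrow> U s \<noteq> 0"
    and bound: "\<And>s. s \<in> Hr_closed \<Longrightarrow> norm (U s - V s) \<le> \<sigma> * norm (U s)" and \<sigma>: "\<sigma> < 1"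
  shows "\<exists>K. rep (\<lambda>s. 1 / V s) K"
proof -
  have D: "rep (\<lambda>s. (U s - V s) * (1 / U s)) ((M + N) * K)"
    by (intro rep_mult rep_diff U V invU)
  have "norm ((U s - V s) * (1 / U s)) \<le> \<sigma>" if "s \<in> Hr_closed" for s
    using bound[OF that] U0[OF that] by (simp add: norm_mult norm_divide field_simps)
  then obtain K' where K': "rep (\<lambda>s. 1 / (1 - (U s - V s) * (1 / U s))) K'"
    using rep_inverse_one_minus[OF D _ \<sigma>] by blast
  have "rep (\<lambda>s. 1 / V s) (K * K')"
    by (rule rep_cong[OF rep_mult[OF invU K']]) (use U0 in \<open>auto simp: field_simps\<close>)
  then show ?thesis by blast
qed

lemma rep_inverse:
  assumes F: "rep F M" and \<delta>: "0 < \<delta>" and lower: "\<And>s. s \<in> Hr_closed \<Longrightarrow> \<delta> \<le> norm (F s)"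
  shows "\<exists>N. rep (\<lambda>s. 1 / F s) N"
proof -
  obtain \<eta> where \<eta>: "\<eta> > 0"
    and \<eta>': "\<And>t u. 0 \<le> t \<Longrightarrow> 0 \<le> u \<Longrightarrow> \<bar>t - u\<bar> \<le> \<eta> \<Longrightarrow> rep (\<lambda>s. F (shift t s) - F (shift u s)) (\<delta> / 2)"
    using rep_shift_uniform[OF F half_gt_zero[OF \<delta>]] by blast
  obtain c T where T: "0 \<le> T" and c: "rep (\<lambda>s. F (shift T s) - c) (\<delta> / 4)"
    using rep_shift_at_infinity[OF F, of "\<delta> / 4"] \<delta> by auto
  have low: "\<delta> \<le> norm (F (shift t s))" if "s \<in> Hr_closed" "0 \<le> t" for s t
    using lower shift_Hr_closed that by blast
  \<comment> \<open>Truncation makes the sequence reach 0 exactly without lengthening any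
    step.\<close>
  define \<tau> where "\<tau> n = max 0 (T - real n * \<eta>)" for n
  have \<tau>: "0 \<le> \<tau> n" "\<bar>\<tau> n - \<tau> (Suc n)\<bar> \<le> \<eta>" for n
    using \<eta> by (auto simp: \<tau>_def algebra_simps)
  have *: "\<exists>N. rep (\<lambda>s. 1 / F (shift (\<tau> n) s)) N" for n
  proof (induction n)
    case 0
    have z: "(0::complex^'r) \<in> Hr_closed" by (simp add: Hr_closed_def)
    \<comment> \<open>One point suffices, as \<open>c\<close> is constant: its modulus is at least
      \<open>3 * \<delta> / 4\<close>, so an error of \<open>\<delta> / 4\<close> is at most half of
      it.\<close>
    have "\<delta> \<le> norm c + \<delta> / 4"
      using low[OF z T] rep_norm_le[OF c z] norm_triangle_sub[of "F (shift T 0)" c] by linarith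
    then have c_low: "\<delta> / 4 \<le> (1 / 2) * norm c" "c \<noteq> 0" using \<delta> by auto
    have "\<exists>N. rep (\<lambda>s. 1 / F (shift T s)) N"
    proof (rule rep_inverse_perturb[OF rep_const rep_shift[OF F T] rep_const])
      show "norm (c - F (shift T s)) \<le> (1 / 2) * norm c" if "s \<in> Hr_closed" for s
        using rep_norm_le[OF c that] c_low by (simp add: norm_minus_commute)
    qed (use c_low in auto)
    then show ?case using T by (simp add: \<tau>_def)
  next
    case (Suc n)
    then obtain N where N: "rep (\<lambda>s. 1 / F (shift (\<tau> n) s)) N" by blast
    show ?case
    proof (rule rep_inverse_perturb[OF rep_shift[OF F] rep_shift[OF F] N])
      fix s :: "complex^'r" assume s: "s \<in> Hr_closed"
      show "F (shift (\<tau> n) s) \<noteq> 0" using low[OF s \<tau>(1)[of n]] \<delta> by auto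
      have "norm (F (shift (\<tau> n) s) - F (shift (\<tau> (Suc n)) s)) \<le> \<delta> / 2"
        using rep_norm_le[OF \<eta>' s] \<tau> by blast
      then show "norm (F (shift (\<tau> n) s) - F (shift (\<tau> (Suc n)) s)) \<le> (1 / 2) * norm (F (shift (\<tau> n) s))"
        using low[OF s \<tau>(1)[of n]] by simp
    qed (use \<tau> in auto)
  qed
  obtain n where "T < real n * \<eta>" using ex_less_of_nat_mult[OF \<eta>] by blast
  then have "\<tau> n = 0" by (simp add: \<tau>_def)
  then show ?thesis using *[of n] by simp
qed

end

section \<open>A Cauchy formula around a compact set\<close>

text \<open>The pair \<open>(c, k)\<close> with \<open>k < 4\<close> stands for the \<open>k\<close>-th side, counterclockwise from the bottom,
  of the square with centre \<open>c\<close> and side length \<open>h\<close>.\<close>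

definition edge_start :: "real \<Rightarrow> complex \<times> nat \<Rightarrow> complex" where
  "edge_start h x = fst x + of_real (h / 2) * (- 1 - \<i>) * \<i> ^ snd x"

definition edge_end :: "real \<Rightarrow> complex \<times> nat \<Rightarrow> complex" where
  "edge_end h x = fst x + of_real (h / 2) * (1 - \<i>) * \<i> ^ snd x"

definition square :: "real \<Rightarrow> complex \<Rightarrow> complex set" where
  "square h c = cbox (c - of_real (h / 2) * (1 + \<i>)) (c + of_real (h / 2) * (1 + \<i>))"

text \<open>The same side as seen from the adjacent square, hence with the reverse orientation.\<close>

definition opposite :: "real \<Rightarrow> complex \<times> nat \<Rightarrow> complex \<times> nat" where
  "opposite h x = (fst x - \<i> * of_real h * \<i> ^ snd x, (snd x + 2) mod 4)"

section \<open>Geometry of squares and their edges, and integrals along them\<close>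

lemma in_square_iff: "u \<in> square h c \<longleftrightarrow> \<bar>Re u - Re c\<bar> \<le> h / 2 \<and> \<bar>Im u - Im c\<bar> \<le> h / 2"
  unfolding square_def in_cbox_complex_iff abs_le_iff by auto

lemma in_interior_square_iff:
  "u \<in> interior (square h c) \<longleftrightarrow> \<bar>Re u - Re c\<bar> < h / 2 \<and> \<bar>Im u - Im c\<bar> < h / 2"
  unfolding square_def interior_cbox in_box_complex_iff abs_less_iff by auto

lemma dist_edge: "0 \<le> h \<Longrightarrow> dist (edge_start h x) (edge_end h x) = h"
proof -
  assume h: "0 \<le> h"
  have "edge_end h x - edge_start h x = of_real h * \<i> ^ snd x"
    by (simp add: edge_start_def edge_end_def field_simps)
  then show ?thesis using h by (simp add: dist_norm norm_minus_commute norm_mult norm_power)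
qed

lemma less_4_cases: "(k::nat) < 4 \<Longrightarrow> k = 0 \<or> k = 1 \<or> k = 2 \<or> k = 3"
  by auto

lemma closed_segment_edge_subset:
  assumes "0 \<le> h" "snd x < 4"
  shows "closed_segment (edge_start h x) (edge_end h x) \<subseteq> square h (fst x)"
proof (rule closed_segment_subset)
  show "edge_start h x \<in> square h (fst x)" "edge_end h x \<in> square h (fst x)"
    using less_4_cases[OF assms(2)] assms(1)
    by (auto simp: in_square_iff edge_start_def edge_end_def power3_eq_cube algebra_simps)
qed (simp add: square_def)

lemma edge_opposite:
  assumes "snd x < 4"
  shows "edge_start h (opposite h x) = edge_end h x" "edge_end h (opposite h x) = edge_start h x"
    "opposite h (opposite h x) = x" "snd (opposite h x) < 4"
  using less_4_cases[OF assms]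
  by (cases x; auto simp: opposite_def edge_start_def edge_end_def power3_eq_cube complex_eq_iff field_simps)+

lemma rectpath_edges:
  assumes "0 \<le> h"
  shows "rectpath (c - of_real (h / 2) * (1 + \<i>)) (c + of_real (h / 2) * (1 + \<i>)) =
    linepath (edge_start h (c, 0)) (edge_end h (c, 0)) +++ linepath (edge_start h (c, 1)) (edge_end h (c, 1)) +++
    linepath (edge_start h (c, 2)) (edge_end h (c, 2)) +++ linepath (edge_start h (c, 3)) (edge_end h (c, 3))"
proof -
  have "c - of_real (h / 2) * (1 + \<i>) = edge_start h (c, 0)"
    "Complex (Re (c + of_real (h / 2) * (1 + \<i>))) (Im (c - of_real (h / 2) * (1 + \<i>))) = edge_end h (c, 0)"
    "c + of_real (h / 2) * (1 + \<i>) = edge_start h (c, 2)"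
    "Complex (Re (c - of_real (h / 2) * (1 + \<i>))) (Im (c + of_real (h / 2) * (1 + \<i>))) = edge_end h (c, 2)"
    "edge_start h (c, 1) = edge_end h (c, 0)" "edge_end h (c, 1) = edge_start h (c, 2)"
    "edge_start h (c, 3) = edge_end h (c, 2)" "edge_end h (c, 3) = edge_start h (c, 0)"
    by (simp_all add: edge_start_def edge_end_def complex_eq_iff power3_eq_cube)
  then show ?thesis by (simp only: rectpath_def Let_def)
qed

text \<open>Cauchy's integral formula applies inside the square and Cauchy's theorem outside. On the
  boundary the integrand may have a pole on the path, so such \<open>z\<close> are excluded.\<close>

lemma integral_square_boundary:
  assumes h: "0 < h" and f: "f holomorphic_on square h c"
    and z: "z \<in> interior (square h c) \<or> z \<notin> square h c"
  shows "(\<Sum>k<4. contour_integral (linepath (edge_start h (c, k)) (edge_end h (c, k))) (\<lambda>u. f u / (u - z)))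
    = (if z \<in> interior (square h c) then 2 * pi * \<i> * f z else 0)"
proof -
  let ?a = "c - of_real (h / 2) * (1 + \<i>)" and ?b = "c + of_real (h / 2) * (1 + \<i>)"
  let ?g = "\<lambda>u. f u / (u - z)"
  have ab: "Re ?a \<le> Re ?b" "Im ?a \<le> Im ?b" using h by auto
  have img: "path_image (rectpath ?a ?b) \<subseteq> square h c"
    using path_image_rectpath_subset_cbox[OF ab] by (simp add: square_def)
  have avoid: "z \<notin> path_image (rectpath ?a ?b)"
    using z img path_image_rectpath_inter_box[OF ab] by (auto simp: square_def)
  have total: "(?g has_contour_integral (if z \<in> interior (square h c) then 2 * pi * \<i> * f z else 0)) (rectpath ?a ?b)"
  proof (cases "z \<in> interior (square h c)")
    case True
    then have "winding_number (rectpath ?a ?b) z = 1"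
      by (intro winding_number_rectpath) (simp add: square_def)
    moreover have "(?g has_contour_integral (2 * pi * \<i> * winding_number (rectpath ?a ?b) z * f z)) (rectpath ?a ?b)"
      by (rule Cauchy_integral_formula_convex_simple[OF _ f True])
        (use img avoid in \<open>auto simp: square_def\<close>)
    ultimately show ?thesis using True by simp
  next
    case False
    then have "z \<notin> square h c" using z by simp
    then have "?g holomorphic_on square h c"
      by (intro holomorphic_intros f) auto
    then have "(?g has_contour_integral 0) (rectpath ?a ?b)"
      by (rule Cauchy_theorem_convex_simple) (use img in \<open>auto simp: square_def\<close>)
    then show ?thesis using False by simp
  qed
  have int: "?g contour_integrable_on linepath (edge_start h (c, k)) (edge_end h (c, k))" if "k < 4" for k
  proof (rule contour_integrable_continuous_linepath)
    have sub: "closed_segment (edge_start h (c, k)) (edge_end h (c, k)) \<subseteq> square h c"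
      using closed_segment_edge_subset[of h "(c, k)"] h that by simp
    have "closed_segment (edge_start h (c, k)) (edge_end h (c, k)) \<subseteq> path_image (rectpath ?a ?b)"
      using less_4_cases[OF that] h
      by (subst rectpath_edges) (auto simp: path_image_join edge_start_def edge_end_def power3_eq_cube algebra_simps)
    then have "z \<notin> closed_segment (edge_start h (c, k)) (edge_end h (c, k))" using avoid by blast
    then show "continuous_on (closed_segment (edge_start h (c, k)) (edge_end h (c, k))) ?g"
      by (intro continuous_intros continuous_on_subset[OF holomorphic_on_imp_continuous_on[OF f] sub]) auto
  qed
  have conn: "edge_end h (c, 0) = edge_start h (c, 1)" "edge_end h (c, 1) = edge_start h (c, 2)"
    "edge_end h (c, 2) = edge_start h (c, 3)"
    by (simp_all add: edge_start_def edge_end_def power3_eq_cube algebra_simps)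
  have four: "sum T {..<4} = T 0 + T 1 + T 2 + T 3" for T :: "nat \<Rightarrow> complex"
    by (simp add: eval_nat_numeral lessThan_Suc)
  have "contour_integral (rectpath ?a ?b) ?g
      = (\<Sum>k<4. contour_integral (linepath (edge_start h (c, k)) (edge_end h (c, k))) ?g)"
    using h int[of 0] int[of 1] int[of 2] int[of 3]
    by (subst rectpath_edges)
      (auto simp: contour_integral_join contour_integrable_join valid_path_join conn four simp del: One_nat_def)
  then show ?thesis using contour_integral_unique[OF total] by simp
qed

text \<open>Such a Cauchy type integral is even differentiable off the segment. This serves to pass
  to the limit from points off the grid lines to arbitrary ones.\<close>

lemma isCont_contour_integral_linepath:
  assumes f: "continuous_on (closed_segment p q) f" and z: "z \<notin> closed_segment p q"
  shows "isCont (\<lambda>z. contour_integral (linepath p q) (\<lambda>u. f u / (u - z))) z"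
proof -
  have "((\<lambda>z. contour_integral (linepath p q) (\<lambda>u. f u / (u - z))) has_field_derivative
      (of_nat 1 * contour_integral (linepath p q) (\<lambda>u. f u / (u - z) ^ Suc 1))) (at z)"
  proof (rule Cauchy_next_derivative(2)[where B = "norm (q - p)" and S = UNIV])
    fix w assume "w \<in> UNIV - path_image (linepath p q)"
    then have "continuous_on (closed_segment p q) (\<lambda>u. f u / (u - w))"
      by (intro continuous_intros f) auto
    then show "((\<lambda>u. f u / (u - w) ^ 1) has_contour_integral
        contour_integral (linepath p q) (\<lambda>u. f u / (u - w))) (linepath p q)"
      by (simp add: contour_integrable_continuous_linepath has_contour_integral_integral)
  qed (use f z in auto)
  then show ?thesis by (rule DERIV_isCont)
qed


section \<open>The square grid\<close>

lemma dist_square_le: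
  assumes "u \<in> square h c" "v \<in> square h c"
  shows "dist u v \<le> 2 * h"
proof -
  have "dist u v \<le> \<bar>Re (u - v)\<bar> + \<bar>Im (u - v)\<bar>"
    unfolding dist_norm by (rule cmod_le)
  also have "\<dots> \<le> 2 * h"
    using assms unfolding in_square_iff minus_complex.sel by linarith
  finally show ?thesis .
qed

text \<open>These are the centres of the grid squares; the grid lines run at odd multiples of
  \<open>h / 2\<close>.\<close>

definition lattice :: "real \<Rightarrow> complex set" where
  "lattice h = range (\<lambda>(m, n). of_real h * Complex (of_int m) (of_int n))"

lemma lattice_opposite:
  assumes "fst x \<in> lattice h" "snd x < 4"
  shows "fst (opposite h x) \<in> lattice h"
proof -
  obtain m n where x: "fst x = of_real h * Complex (of_int m) (of_int n)"
    using assms(1) by (auto simp: lattice_def)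
  \<comment> \<open>The neighbours below, right, above and left belong to the sides 0, 1, 2, 3 in
    this order.\<close>
  have "fst (opposite h x) \<in> (\<lambda>(m, n). of_real h * Complex (of_int m) (of_int n)) `
      {(m, n - 1), (m + 1, n), (m, n + 1), (m - 1, n)}"
    using less_4_cases[OF assms(2)]
    by (auto simp: opposite_def x complex_eq_iff power3_eq_cube algebra_simps)
  then show ?thesis unfolding lattice_def by blast
qed

text \<open>Approaching \<open>z\<close> from the upper right avoids the lines of the grid.\<close>

lemma eventually_interior_square:
  assumes "0 < h"
  obtains c where "c \<in> lattice h"
    "\<forall>\<^sub>F \<delta> in at_right (0::real). z + of_real \<delta> * (1 + \<i>) \<in> interior (square h c)"
proof -
  \<comment> \<open>Rounding to the nearest integer, with ties upward: a point on a grid line is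
    assigned to the square into whose interior a small positive \<open>\<delta>\<close> moves
    it.\<close>
  define p where "p x = (\<lfloor>x / h + 1 / 2\<rfloor> :: int)" for x
  have p: "\<forall>\<^sub>F \<delta> in at_right 0. \<bar>x + \<delta> - h * of_int (p x)\<bar> < h / 2" for x
  proof -
    have "of_int (p x) \<le> x / h + 1 / 2" "x / h + 1 / 2 < of_int (p x) + 1"
      unfolding p_def by linarith+
    then have lo: "h * of_int (p x) \<le> x + h / 2" and hi: "x + h / 2 < h * of_int (p x) + h"
      using assms by (auto simp: field_simps)
    have "0 < h * of_int (p x) + h - (x + h / 2)" using hi by simp
    then have "\<forall>\<^sub>F \<delta> in at_right 0. \<delta> \<in> {0<..<h * of_int (p x) + h - (x + h / 2)}"
      by (rule eventually_at_right_real)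
    then show ?thesis
      by eventually_elim (use lo hi in \<open>unfold greaterThanLessThan_iff abs_less_iff, linarith\<close>)
  qed
  define c where "c = of_real h * Complex (of_int (p (Re z))) (of_int (p (Im z)))"
  have "\<forall>\<^sub>F \<delta> in at_right 0. z + of_real \<delta> * (1 + \<i>) \<in> interior (square h c)"
    using p[of "Re z"] p[of "Im z"]
    by eventually_elim (auto simp: in_interior_square_iff c_def)
  moreover have "c \<in> lattice h"
    unfolding lattice_def c_def by (rule image_eqI[where x = "(p (Re z), p (Im z))"]) auto
  ultimately show thesis by (rule that[rotated])
qed

text \<open>In each coordinate the centres are at distance less than \<open>h\<close>, so their
  integer indices agree. The second square is closed: a point interior to one square avoids even the
  boundaries of the others.\<close>

lemma interior_square_unique:
  assumes h: "0 < h" and "c \<in> lattice h" "d \<in> lattice h"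
    and z: "z \<in> interior (square h c)" "z \<in> square h d"
  shows "c = d"
proof -
  obtain m n m' n' where c: "c = of_real h * Complex (of_int m) (of_int n)"
    and d: "d = of_real h * Complex (of_int m') (of_int n')"
    using assms(2,3) by (auto simp: lattice_def)
  have *: "i = j" if "\<bar>x - h * of_int i\<bar> < h / 2" "\<bar>x - h * of_int j\<bar> \<le> h / 2" for i j :: int and x
  proof -
    have "\<bar>h * of_int i - h * of_int j\<bar> < h * 1" using that by linarith
    then have "h * \<bar>of_int i - of_int j\<bar> < h * 1"
      using h by (simp only: right_diff_distrib[symmetric] abs_mult)
    then have "\<bar>of_int i - of_int j\<bar> < (1::real)" using h by (simp only: mult_less_cancel_left_pos)
    then show "i = j" by linarith
  qed
  have "m = m'" by (rule *[of "Re z"]) (use z in \<open>auto simp: in_interior_square_iff in_square_iff c d\<close>)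
  moreover have "n = n'" by (rule *[of "Im z"]) (use z in \<open>auto simp: in_interior_square_iff in_square_iff c d\<close>)
  ultimately show ?thesis by (simp add: c d)
qed

lemma finite_lattice_bounded: 
  assumes h: "0 < h"
  shows "finite {c \<in> lattice h. norm c \<le> B}"
proof -
  define N where "N = \<lceil>B / h\<rceil>"
  have "{c \<in> lattice h. norm c \<le> B} \<subseteq>
      (\<lambda>(m, n). of_real h * Complex (of_int m) (of_int n)) ` ({- N..N} \<times> {- N..N})"
  proof
    fix c assume "c \<in> {c \<in> lattice h. norm c \<le> B}"
    then obtain m n where c: "c = of_real h * Complex (of_int m) (of_int n)" and B: "norm c \<le> B"
      by (auto simp: lattice_def)
    have *: "\<bar>i\<bar> \<le> N" if "\<bar>h * of_int i\<bar> \<le> B" for i :: int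
    proof -
      have "of_int \<bar>i\<bar> \<le> B / h" using that h by (simp add: abs_mult field_simps)
      then show ?thesis unfolding N_def by linarith
    qed
    have "\<bar>h * of_int m\<bar> \<le> B" "\<bar>h * of_int n\<bar> \<le> B"
      using abs_Re_le_cmod[of c] abs_Im_le_cmod[of c] B by (auto simp: c)
    then have "(m, n) \<in> {- N..N} \<times> {- N..N}" using *[of m] *[of n] by auto
    then show "c \<in> (\<lambda>(m, n). of_real h * Complex (of_int m) (of_int n)) ` ({- N..N} \<times> {- N..N})"
      by (intro image_eqI[where x = "(m, n)"]) (auto simp: c)
  qed
  then show ?thesis by (rule finite_subset) auto
qed

text \<open>The sum of Cauchy's formulas over the grid squares near \<open>K\<close>. Edges shared by two of the squares
  cancel, so the remaining ones keep away from \<open>K\<close>.\<close>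

lemma Cauchy_integral_formula_compact:
  assumes K: "compact K" "K \<subseteq> G" and G: "open G" and f: "f holomorphic_on G"
  obtains J h where "finite J" "0 < h"
    "\<And>x. x \<in> J \<Longrightarrow> closed_segment (edge_start h x) (edge_end h x) \<subseteq> G"
    "\<And>x z u. x \<in> J \<Longrightarrow> z \<in> K \<Longrightarrow> u \<in> closed_segment (edge_start h x) (edge_end h x) \<Longrightarrow> h < dist z u"
    "\<And>z. z \<in> K \<Longrightarrow> (\<Sum>x\<in>J. contour_integral (linepath (edge_start h x) (edge_end h x)) (\<lambda>u. f u / (u - z)))
       = 2 * pi * \<i> * f z"
proof -
  obtain e where e: "e > 0" "(\<Union>z\<in>K. ball z e) \<subseteq> G"
    using compact_subset_open_imp_ball_epsilon_subset[OF K(1) G K(2)] by blast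
  \<comment> \<open>Points of the selected squares are within \<open>3 * h\<close> of
    \<open>K\<close>: \<open>h\<close> to a nearby point of the square, and at most
    \<open>2 * h\<close> across it. So these squares stay in \<open>G\<close>.\<close>
  define h where "h = e / 4"
  have h: "0 < h" "3 * h < e" using e by (auto simp: h_def)
  \<comment> \<open>All squares coming within \<open>h\<close> of \<open>K\<close> are taken, not
    only those meeting it. Thus the surviving edges are farther from \<open>K\<close> than their own
    length, which the later expansion requires.\<close>
  define S where "S = {c \<in> lattice h. \<exists>u\<in>square h c. \<exists>z\<in>K. dist z u \<le> h}"
  have near: "\<exists>z\<in>K. dist z v \<le> 3 * h" if c: "c \<in> S" "v \<in> square h c" for c v
  proof -
    obtain u z where uz: "u \<in> square h c" "z \<in> K" "dist z u \<le> h" using c by (auto simp: S_def)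
    then have "dist z v \<le> 3 * h"
      using dist_square_le[OF uz(1) c(2)] dist_triangle[of z v u] by simp
    with uz show ?thesis by blast
  qed
  have SG: "square h c \<subseteq> G" if "c \<in> S" for c
  proof
    fix v assume "v \<in> square h c"
    then obtain z where "z \<in> K" "dist z v \<le> 3 * h" using near \<open>c \<in> S\<close> by blast
    then show "v \<in> G" using h e by (auto intro!: subsetD[OF e(2)] bexI[of _ z])
  qed
  have finS: "finite S"
  proof -
    obtain B where B: "\<And>z. z \<in> K \<Longrightarrow> norm z \<le> B"
      using compact_imp_bounded[OF K(1)] by (auto simp: bounded_iff)
    have "norm c \<le> B + 3 * h" if "c \<in> S" for c
    proof -
      have "c \<in> square h c" using h by (simp add: in_square_iff)
      then obtain z where z: "z \<in> K" "dist z c \<le> 3 * h" using near[OF \<open>c \<in> S\<close>] by blast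
      then show ?thesis using B[OF z(1)] norm_triangle_sub[of c z] by (simp add: dist_norm norm_minus_commute)
    qed
    then have "S \<subseteq> {c \<in> lattice h. norm c \<le> B + 3 * h}" by (auto simp: S_def)
    then show ?thesis using finite_lattice_bounded[OF h(1)] finite_subset by blast
  qed
  define I where "I = S \<times> {..<4::nat}"
  \<comment> \<open>The edges belonging to exactly one selected square.\<close>
  define J where "J = {x \<in> I. opposite h x \<notin> I}"
  have finI: "finite I" using finS by (simp add: I_def)
  have seg: "closed_segment (edge_start h x) (edge_end h x) \<subseteq> square h (fst x)" if "snd x < 4" for x
    using closed_segment_edge_subset[OF _ that] h by simp
  have JG: "closed_segment (edge_start h x) (edge_end h x) \<subseteq> G" if "x \<in> J" for x
  proof -
    have "fst x \<in> S" "snd x < 4" using that by (auto simp: J_def I_def)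
    then show ?thesis using seg[of x] SG[of "fst x"] by blast
  qed
  \<comment> \<open>An edge with a point within \<open>h\<close> of \<open>K\<close> also bounds the
    adjacent square, which is then selected as well, so the edge would have cancelled.\<close>
  have far: "h < dist z u"
    if x: "x \<in> J" and z: "z \<in> K" and u: "u \<in> closed_segment (edge_start h x) (edge_end h x)" for x z u
  proof (rule ccontr)
    assume "\<not> h < dist z u"
    have x4: "fst x \<in> lattice h" "snd x < 4" using x by (auto simp: J_def I_def S_def)
    have "u \<in> closed_segment (edge_start h (opposite h x)) (edge_end h (opposite h x))"
      unfolding edge_opposite(1,2)[OF x4(2)] using u by (simp add: closed_segment_commute)
    then have "u \<in> square h (fst (opposite h x))"
      using seg[OF edge_opposite(4)[OF x4(2)]] by blast
    then have "fst (opposite h x) \<in> S"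
      using lattice_opposite[OF x4] z \<open>\<not> h < dist z u\<close> by (force simp: S_def)
    then have "opposite h x \<in> I"
      using edge_opposite(4)[OF x4(2)] by (simp add: I_def mem_Times_iff)
    then show False using x by (simp add: J_def)
  qed
  define T where "T z x = contour_integral (linepath (edge_start h x) (edge_end h x)) (\<lambda>u. f u / (u - z))" for z x
  have cancel: "sum (T z) I = sum (T z) J" for z
  proof -
    let ?I = "{x \<in> I. opposite h x \<in> I}"
    have op: "opposite h (opposite h x) = x" "T z (opposite h x) = - T z x" if "x \<in> I" for x
    proof -
      have x4: "snd x < 4" using that by (auto simp: I_def)
      show "opposite h (opposite h x) = x" by (rule edge_opposite[OF x4])
      show "T z (opposite h x) = - T z x"
        unfolding T_def edge_opposite[OF x4]
        using contour_integral_reversepath[of "linepath (edge_start h x) (edge_end h x)"] by simp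
    qed
    \<comment> \<open>The involution \<open>opposite\<close> reverses the sign of every integral, so
      the sum equals its own negative.\<close>
    have "sum (T z) ?I = (\<Sum>x\<in>?I. T z (opposite h x))"
      by (rule sum.reindex_bij_witness[of _ "opposite h" "opposite h"]) (auto simp: op)
    also have "\<dots> = - sum (T z) ?I"
      by (simp add: op sum_negf)
    finally have "sum (T z) ?I = 0" by simp
    moreover have "I = J \<union> ?I" "J \<inter> ?I = {}" by (auto simp: J_def)
    ultimately show ?thesis
      using sum.union_disjoint[of J ?I "T z"] finI by (simp add: J_def)
  qed
  have fcont: "continuous_on G f" by (rule holomorphic_on_imp_continuous_on[OF f])
  have formula: "sum (T z) J = 2 * pi * \<i> * f z" if z: "z \<in> K" for z
  proof -
    define y where "y \<delta> = z + of_real \<delta> * (1 + \<i>)" for \<delta>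
    have y: "(y \<longlongrightarrow> z) (at_right 0)"
    proof -
      have "(y \<longlongrightarrow> z + of_real 0 * (1 + \<i>)) (at_right 0)"
        unfolding y_def by (intro tendsto_intros)
      then show ?thesis by simp
    qed
    obtain c where c: "c \<in> lattice h" "\<forall>\<^sub>F \<delta> in at_right 0. y \<delta> \<in> interior (square h c)"
      using eventually_interior_square[OF h(1), of z] unfolding y_def by blast
    have "\<forall>\<^sub>F \<delta> in at_right 0. dist (y \<delta>) z < h"
      using tendstoD[OF y h(1)] .
    then have "\<forall>\<^sub>F \<delta> in at_right 0. sum (T (y \<delta>)) J = 2 * pi * \<i> * f (y \<delta>)"
      using c(2)
    proof eventually_elim
      case (elim \<delta>)
      let ?y = "y \<delta>"
      have "\<exists>u\<in>square h c. \<exists>z\<in>K. dist z u \<le> h"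
      proof (intro bexI)
        show "dist z ?y \<le> h" using elim(1) by (simp add: dist_commute)
        show "?y \<in> square h c" using elim(2) interior_subset by blast
      qed (rule z)
      then have "c \<in> S" using c(1) by (simp add: S_def)
      have inner: "(\<Sum>k<4. T ?y (d, k)) = (if d = c then 2 * pi * \<i> * f ?y else 0)" if "d \<in> S" for d
      proof -
        have dl: "d \<in> lattice h" using that by (simp add: S_def)
        have "?y \<notin> square h d" if "d \<noteq> c"
          using interior_square_unique[OF h(1) c(1) dl elim(2)] that by blast
        then show ?thesis
          using integral_square_boundary[OF h(1) holomorphic_on_subset[OF f SG[OF \<open>d \<in> S\<close>]], of ?y] elim(2)
            interior_subset[of "square h d"]
          unfolding T_def by (cases "d = c") auto
      qed
      have "sum (T ?y) J = (\<Sum>d\<in>S. \<Sum>k<4. T ?y (d, k))"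
        unfolding cancel[symmetric] I_def by (simp add: sum.cartesian_product)
      also have "\<dots> = (\<Sum>d\<in>S. if d = c then 2 * pi * \<i> * f ?y else 0)"
        by (rule sum.cong) (auto simp: inner)
      also have "\<dots> = 2 * pi * \<i> * f ?y"
        using finS \<open>c \<in> S\<close> by simp
      finally show ?case .
    qed
    moreover have "((\<lambda>\<delta>. sum (T (y \<delta>)) J) \<longlongrightarrow> sum (T z) J) (at_right 0)"
    proof (rule tendsto_sum)
      fix x assume x: "x \<in> J"
      have "z \<notin> closed_segment (edge_start h x) (edge_end h x)"
        using far[OF x z, of z] h by auto
      then have "isCont (\<lambda>z. T z x) z"
        unfolding T_def by (intro isCont_contour_integral_linepath continuous_on_subset[OF fcont JG[OF x]])
      then show "((\<lambda>\<delta>. T (y \<delta>) x) \<longlongrightarrow> T z x) (at_right 0)"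
        by (rule isCont_tendsto_compose[OF _ y])
    qed
    ultimately have "((\<lambda>\<delta>. 2 * pi * \<i> * f (y \<delta>)) \<longlongrightarrow> sum (T z) J) (at_right 0)"
      by (rule Lim_transform_eventually[rotated])
    moreover have "((\<lambda>\<delta>. 2 * pi * \<i> * f (y \<delta>)) \<longlongrightarrow> 2 * pi * \<i> * f z) (at_right 0)"
    proof (intro tendsto_intros)
      have "isCont f z" using fcont G K(2) z by (auto simp: continuous_on_eq_continuous_at)
      then show "((\<lambda>\<delta>. f (y \<delta>)) \<longlongrightarrow> f z) (at_right 0)"
        by (rule isCont_tendsto_compose[OF _ y])
    qed
    ultimately show ?thesis
      by (rule tendsto_unique[rotated]) simp
  qed
  have "finite J" using finI by (simp add: J_def)
  then show thesis
    using that h(1) JG far formula unfolding T_def by blast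
qed

section \<open>Holomorphic functions of a transform\<close>

text \<open>On the segment \<open>(u - p) / (z - p)\<close> has modulus at most
  \<open>dist p q / dist z p\<close>, which is below 1. The geometric series in it is integrated
  term by term; \<open>z\<close> enters the terms only through powers of
  \<open>1 / (z - p)\<close>.\<close>

lemma contour_integral_linepath_expansion:
  assumes f: "continuous_on (closed_segment p q) f" and z: "dist p q < dist z p"
    and far: "\<And>u. u \<in> closed_segment p q \<Longrightarrow> u \<noteq> z"
  shows "(\<lambda>k. - contour_integral (linepath p q) (\<lambda>u. f u * (u - p) ^ k) * (1 / (z - p)) ^ Suc k)
    sums contour_integral (linepath p q) (\<lambda>u. f u / (u - z))"
proof -
  let ?C = "contour_integral (linepath p q)"
  have zp: "z \<noteq> p" using z by auto
  have cont: "continuous_on (closed_segment p q) (\<lambda>u. f u / (u - z))"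
    using far by (intro continuous_intros f) auto
  have cont_k: "continuous_on (closed_segment p q) (\<lambda>u. f u * (u - p) ^ k)" for k
    by (intro continuous_intros f)
  obtain B where B: "B \<ge> 0" "\<And>u. u \<in> closed_segment p q \<Longrightarrow> norm (f u / (u - z)) \<le> B"
  proof -
    have "bounded ((\<lambda>u. f u / (u - z)) ` closed_segment p q)"
      by (intro compact_imp_bounded compact_continuous_image cont) auto
    then obtain B where "\<And>u. u \<in> closed_segment p q \<Longrightarrow> norm (f u / (u - z)) \<le> B"
      by (auto simp: bounded_iff)
    then show thesis
      using that[of B] order_trans[OF norm_ge_zero] ends_in_segment(1) by blast
  qed
  define \<rho> where "\<rho> = dist p q / dist z p"
  have \<rho>: "0 \<le> \<rho>" "\<rho> < 1" using z zp by (auto simp: \<rho>_def)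
  \<comment> \<open>The remainder of the finite geometric sum is kept exactly, so that no limit has
    to be interchanged with the integral.\<close>
  have geom: "f u / (u - z) = (\<Sum>k<n. - (f u * (u - p) ^ k) * (1 / (z - p)) ^ Suc k)
      + f u / (u - z) * ((u - p) / (z - p)) ^ n" if "u \<noteq> z" for u n
  proof (induction n)
    case (Suc n)
    define a b where "a = f u / (u - z)" and "b = (u - p) / (z - p)"
    have b: "1 - b = - ((u - z) / (z - p))"
      using zp by (simp add: b_def field_simps)
    have a: "a * (u - z) = f u" using that by (simp add: a_def)
    have "a - a * b = a * (1 - b)" by (simp add: right_diff_distrib)
    also have "\<dots> = - (a * (u - z)) / (z - p)" by (simp add: b)
    finally have diff: "a - a * b = - f u / (z - p)" unfolding a .
    have "a * b ^ n = (a - a * b) * b ^ n + a * b ^ Suc n"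
      by (simp add: algebra_simps)
    also have "(a - a * b) * b ^ n = - (f u * (u - p) ^ n) * (1 / (z - p)) ^ Suc n"
      unfolding diff by (simp add: b_def power_divide)
    finally have step: "a * b ^ n = - (f u * (u - p) ^ n) * (1 / (z - p)) ^ Suc n + a * b ^ Suc n" .
    have "a = (\<Sum>k<n. - (f u * (u - p) ^ k) * (1 / (z - p)) ^ Suc k) + a * b ^ n"
      using Suc unfolding a_def b_def .
    also have "\<dots> = (\<Sum>k<Suc n. - (f u * (u - p) ^ k) * (1 / (z - p)) ^ Suc k) + a * b ^ Suc n"
      by (simp only: step sum.lessThan_Suc add.assoc)
    finally show ?case unfolding a_def b_def .
  qed simp
  have remainder: "norm (?C (\<lambda>u. f u / (u - z)) - (\<Sum>k<n. - ?C (\<lambda>u. f u * (u - p) ^ k) * (1 / (z - p)) ^ Suc k))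
      \<le> B * \<rho> ^ n * norm (q - p)" for n
  proof (rule has_contour_integral_bound_linepath)
    show "((\<lambda>u. f u / (u - z) - (\<Sum>k<n. - (f u * (u - p) ^ k) * (1 / (z - p)) ^ Suc k)) has_contour_integral
        ?C (\<lambda>u. f u / (u - z)) - (\<Sum>k<n. - ?C (\<lambda>u. f u * (u - p) ^ k) * (1 / (z - p)) ^ Suc k)) (linepath p q)"
      by (intro has_contour_integral_diff has_contour_integral_sum has_contour_integral_rmul
          has_contour_integral_neg has_contour_integral_integral
          contour_integrable_continuous_linepath cont cont_k) auto
    fix u assume u: "u \<in> closed_segment p q"
    have "dist u p \<le> dist p q"
      using segment_bound(1)[OF u] by (simp add: dist_norm norm_minus_commute)
    then have "norm ((u - p) / (z - p)) \<le> \<rho>"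
      using zp by (simp add: \<rho>_def norm_divide dist_norm divide_right_mono)
    then have "norm (f u / (u - z) * ((u - p) / (z - p)) ^ n) \<le> B * \<rho> ^ n"
      unfolding norm_mult norm_power using B u by (intro mult_mono power_mono) auto
    then show "norm (f u / (u - z) - (\<Sum>k<n. - (f u * (u - p) ^ k) * (1 / (z - p)) ^ Suc k)) \<le> B * \<rho> ^ n"
      by (subst geom[OF far[OF u], of n]) simp
  qed (use B \<rho> in auto)
  have "(\<lambda>n. B * \<rho> ^ n * norm (q - p)) \<longlonglongrightarrow> B * 0 * norm (q - p)"
    using \<rho> by (intro tendsto_intros LIMSEQ_realpow_zero)
  then have "(\<lambda>n. ?C (\<lambda>u. f u / (u - z)) - (\<Sum>k<n. - ?C (\<lambda>u. f u * (u - p) ^ k) * (1 / (z - p)) ^ Suc k)) \<longlonglongrightarrow> 0"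
    by (intro Lim_null_comparison[OF always_eventually[OF allI[OF remainder]]]) simp
  from tendsto_diff[OF tendsto_const this, of "?C (\<lambda>u. f u / (u - z))"] show ?thesis
    by (simp add: sums_def)
qed

context admissible_semigroup
begin

text \<open>Together with \<open>rep_imp_gtrans\<close> this translates between \<open>rep\<close>
  and transforms of elements of \<open>Aw L w\<close>.\<close>

lemma rep_gtrans:
  assumes "a \<in> Aw L w"
  obtains M where "rep (gtrans L a) M"
proof
  show "rep (gtrans L a) (infsum (\<lambda>l. norm (a l) * w l) L)"
  proof (rule rep_family[where \<mu> = id and \<alpha> = a and I = L])
    have summ: "(\<lambda>l. norm (a l) * w (id l)) summable_on L" using assms by (simp add: Aw_def)
    then show "((\<lambda>l. norm (a l) * w (id l)) has_sum infsum (\<lambda>l. norm (a l) * w l) L) L"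
      by simp
    fix s :: "complex^'r" assume s: "s \<in> Hr_closed"
    have "(\<lambda>l. norm (a l * exp (- dotc l s))) summable_on L"
      by (rule summable_family[OF _ summ]) (use s norm_exp_dotc_le in auto)
    then have "(\<lambda>l. a l * exp (- dotc l s)) summable_on L" by (rule abs_summable_summable)
    then show "((\<lambda>l. a l * exp (- dotc (id l) s)) has_sum gtrans L a s) L"
      by (simp add: gtrans_def)
  qed auto
qed

lemma rep_imp_gtrans:
  assumes "rep F M"
  shows "\<exists>c\<in>Aw L w. \<forall>s\<in>Hr_closed. F s = gtrans L c s"
proof -
  obtain c m where c: "\<forall>l. l \<notin> L \<longrightarrow> c l = 0" "((\<lambda>l. norm (c l) * w l) has_sum m) L"
    and F: "\<forall>s\<in>Hr_closed. ((\<lambda>l. c l * exp (- dotc l s)) has_sum F s) L"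
    using assms unfolding rep_def by blast
  have "c \<in> Aw L w" using c by (auto simp: Aw_def has_sum_imp_summable)
  moreover have "\<forall>s\<in>Hr_closed. F s = gtrans L c s"
    using F by (auto simp: gtrans_def infsumI)
  ultimately show ?thesis by blast
qed

text \<open>The moments \<open>?m k\<close> are at most \<open>B * r ^ k * r\<close>, and the powers
  of \<open>1 / (F s - p)\<close> have norms growing at rate \<open>q0\<close>. Since
  \<open>q0 * r < 1\<close>, the expansion converges in the weighted norm.\<close>

lemma rep_contour_integral:
  assumes F: "rep F M" and K: "compact K" "\<And>s. s \<in> Hr_closed \<Longrightarrow> F s \<in> K"
    and f: "continuous_on (closed_segment p q) f"
    and far: "\<And>z u. z \<in> K \<Longrightarrow> u \<in> closed_segment p q \<Longrightarrow> dist p q < dist z u"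
  shows "\<exists>N. rep (\<lambda>s. contour_integral (linepath p q) (\<lambda>u. f u / (u - F s))) N"
proof -
  define r where "r = dist p q"
  have K0: "K \<noteq> {}" using K(2)[of 0] by (auto simp: Hr_closed_def)
  \<comment> \<open>By compactness the distance is attained, so \<open>r < d\<close> is strict and
    uniform in \<open>s\<close>.\<close>
  define d where "d = infdist p K"
  obtain z0 where z0: "z0 \<in> K" "d = dist p z0"
    using infdist_attains_inf[OF compact_imp_closed[OF K(1)] K0] unfolding d_def by blast
  have r: "0 \<le> r" "r < d" using far[OF z0(1), of p] z0(2) by (auto simp: r_def dist_commute)
  have Fd: "d \<le> norm (F s - p)" if "s \<in> Hr_closed" for s
    using infdist_le[OF K(2)[OF that], of p] by (simp add: d_def dist_norm norm_minus_commute)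
  have Fp: "rep (\<lambda>s. F s - p) (M + norm p)"
    by (intro rep_diff F rep_const)
  obtain N where inv: "rep (\<lambda>s. 1 / (F s - p)) N"
    using rep_inverse[OF Fp _ Fd] r by auto
  \<comment> \<open>The reciprocal of the midpoint of \<open>r\<close> and \<open>d\<close>: above
    \<open>1 / d\<close>, as the spectral radius bound demands, yet with \<open>q0 * r\<close> below
    1, also for \<open>r = 0\<close>.\<close>
  define q0 where "q0 = 2 / (d + r)"
  have q0: "1 / d < q0" "0 \<le> q0" "q0 * r < 1"
    using r by (auto simp: q0_def field_simps)
  have "norm (1 / (F s - p)) \<le> 1 / d" if "s \<in> Hr_closed" for s
    unfolding norm_divide using Fd[OF that] r by (intro frac_le) auto
  then obtain C where C: "C \<ge> 0" "\<And>k. rep (\<lambda>s. (1 / (F s - p)) ^ k) (C * q0 ^ k)"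
    using rep_powers[OF inv _ q0(1)] by blast
  obtain B where B: "B \<ge> 0" "\<And>u. u \<in> closed_segment p q \<Longrightarrow> norm (f u) \<le> B"
  proof -
    have "bounded (f ` closed_segment p q)"
      by (intro compact_imp_bounded compact_continuous_image f) auto
    then obtain B where "\<And>u. u \<in> closed_segment p q \<Longrightarrow> norm (f u) \<le> B"
      by (auto simp: bounded_iff)
    then show thesis
      using that[of B] order_trans[OF norm_ge_zero] ends_in_segment(1) by blast
  qed
  let ?m = "\<lambda>k. contour_integral (linepath p q) (\<lambda>u. f u * (u - p) ^ k)"
  have m: "norm (- ?m k) \<le> B * r ^ k * r" for k
  proof -
    have "norm (?m k) \<le> B * r ^ k * norm (q - p)"
    proof (rule has_contour_integral_bound_linepath)
      show "((\<lambda>u. f u * (u - p) ^ k) has_contour_integral ?m k) (linepath p q)"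
        by (intro has_contour_integral_integral contour_integrable_continuous_linepath continuous_intros f)
      fix u assume u: "u \<in> closed_segment p q"
      have "norm (u - p) \<le> r"
        using segment_bound(1)[OF u] by (simp add: r_def dist_norm norm_minus_commute)
      then show "norm (f u * (u - p) ^ k) \<le> B * r ^ k"
        unfolding norm_mult norm_power using B u by (intro mult_mono power_mono) auto
    qed (use B r in auto)
    then show ?thesis by (simp add: r_def dist_norm norm_minus_commute)
  qed
  have "rep (\<lambda>s. contour_integral (linepath p q) (\<lambda>u. f u / (u - F s))) ((B * r * C * q0) * (1 / (1 - q0 * r)))"
  proof (rule rep_sums)
    show "(\<lambda>k. (B * r * C * q0) * (q0 * r) ^ k) sums ((B * r * C * q0) * (1 / (1 - q0 * r)))"
      using q0 r by (intro sums_mult geometric_sums) auto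
    show "rep (\<lambda>s. - ?m k * (1 / (F s - p)) ^ Suc k) ((B * r * C * q0) * (q0 * r) ^ k)" for k
    proof (rule rep_mono[OF rep_cmult[OF C(2)]])
      have "norm (- ?m k) * (C * q0 ^ Suc k) \<le> (B * r ^ k * r) * (C * q0 ^ Suc k)"
        using C q0 by (intro mult_right_mono m) auto
      then show "norm (- ?m k) * (C * q0 ^ Suc k) \<le> (B * r * C * q0) * (q0 * r) ^ k"
        by (simp add: power_mult_distrib mult_ac)
    qed
    fix s :: "complex^'r" assume s: "s \<in> Hr_closed"
    show "(\<lambda>k. - ?m k * (1 / (F s - p)) ^ Suc k) sums contour_integral (linepath p q) (\<lambda>u. f u / (u - F s))"
    proof (rule contour_integral_linepath_expansion[OF f])
      show "dist p q < dist (F s) p" using far[OF K(2)[OF s], of p] by simp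
      show "u \<noteq> F s" if "u \<in> closed_segment p q" for u
        using far[OF K(2)[OF s] that] by auto
    qed
  qed
  then show ?thesis by blast
qed

text \<open>The closure of the range is compact because \<open>F\<close> is bounded by its norm, and
  by \<open>rep_in_closure\<close> it contains the boundary values too. So one finite Cauchy formula
  serves all points of the closed half space.\<close>

lemma rep_holomorphic:
  assumes F: "rep F M" and G: "open G" and f: "f holomorphic_on G" and sub: "closure (F ` Hr) \<subseteq> G"
  shows "\<exists>N. rep (\<lambda>s. f (F s)) N"
proof -
  define K where "K = closure (F ` Hr)"
  have mem: "F s \<in> K" if "s \<in> Hr_closed" for s
    unfolding K_def by (rule rep_in_closure[OF F that])
  have "bounded (F ` Hr)"
    unfolding bounded_iff by (rule exI[of _ M]) (auto intro!: rep_norm_le[OF F] simp: Hr_def Hr_closed_def less_imp_le)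
  then have K: "compact K" "K \<subseteq> G"
    using sub by (auto simp: K_def compact_closure)
  obtain J h where J: "finite J" "0 < h"
    and JG: "\<And>x. x \<in> J \<Longrightarrow> closed_segment (edge_start h x) (edge_end h x) \<subseteq> G"
    and far: "\<And>x z u. x \<in> J \<Longrightarrow> z \<in> K \<Longrightarrow> u \<in> closed_segment (edge_start h x) (edge_end h x) \<Longrightarrow> h < dist z u"
    and formula: "\<And>z. z \<in> K \<Longrightarrow>
      (\<Sum>x\<in>J. contour_integral (linepath (edge_start h x) (edge_end h x)) (\<lambda>u. f u / (u - z))) = 2 * pi * \<i> * f z"
    using Cauchy_integral_formula_compact[OF K G f] by blast
  let ?T = "\<lambda>x s. contour_integral (linepath (edge_start h x) (edge_end h x)) (\<lambda>u. f u / (u - F s))"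
  have "\<exists>N. rep (?T x) N" if x: "x \<in> J" for x
  proof (rule rep_contour_integral[OF F K(1) mem])
    show "continuous_on (closed_segment (edge_start h x) (edge_end h x)) f"
      by (rule continuous_on_subset[OF holomorphic_on_imp_continuous_on[OF f] JG[OF x]])
    show "dist (edge_start h x) (edge_end h x) < dist z u"
      if "z \<in> K" "u \<in> closed_segment (edge_start h x) (edge_end h x)" for z u
      using far[OF x that] J(2) by (simp add: dist_edge)
  qed
  then have "\<forall>x\<in>J. \<exists>N. rep (?T x) N" by blast
  from bchoice[OF this] obtain N where "\<forall>x\<in>J. rep (?T x) (N x)" by blast
  then have "rep (\<lambda>s. (1 / (2 * pi * \<i>)) * (\<Sum>x\<in>J. ?T x s)) (norm (1 / (2 * pi * \<i>)) * (\<Sum>x\<in>J. N x))"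
    by (intro rep_cmult rep_sum J) blast
  then have "rep (\<lambda>s. f (F s)) (norm (1 / (2 * pi * \<i>)) * (\<Sum>x\<in>J. N x))"
    by (rule rep_cong) (simp add: formula mem)
  then show ?thesis by blast
qed

end

theorem theorem5:
  fixes L :: "(real^'r) set" and w :: "real^'r \<Rightarrow> real"
    and f :: "complex \<Rightarrow> complex" and G :: "complex set" and a :: "real^'r \<Rightarrow> complex"
  assumes "nonneg_semigroup L"
    and "open G" and "connected G" and "f holomorphic_on G"
    and "admissible_weight L w"
    and "a \<in> Aw L w"
    and "closure (gtrans L a ` Hr) \<subseteq> G"
  shows "\<exists>c \<in> Aw L w. \<forall>s \<in> Hr_closed. f (gtrans L a s) = gtrans L c s"
proof -
  interpret admissible_semigroup L w
    by unfold_locales fact+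
  obtain M where "rep (gtrans L a) M" by (rule rep_gtrans[OF \<open>a \<in> Aw L w\<close>])
  then obtain N where "rep (\<lambda>s. f (gtrans L a s)) N"
    using rep_holomorphic[OF _ \<open>open G\<close> \<open>f holomorphic_on G\<close>] assms(7) by blast
  then show ?thesis by (rule rep_imp_gtrans)
qed

end
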